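(* Let $M\in\mathbb R_+^{m\times m}$ be an entrywise nonnegative matrix, let $\boldsymbol\Delta_{\mathbb{RC}}\subset\mathbb C^{m\times m}$ be the uncertainty structure defined in the context, and let $\bar s:=\sum_{k=f+1}^{f+s}m_k$. If $\mu(M,\boldsymbol\Delta_{\mathbb{RC}})\ge1$, then there exists a matrix $\tilde\Delta=\mathrm{diag}(\Delta_1,\dots,\Delta_f,\delta I_{\bar s})\in\boldsymbol\Delta_{\mathbb{RC}}\cap\mathbb R_+^{m\times m}$ (with $\Delta_k$ of size $m_k\times m_k$ and a single scalar $\delta$) such that $\|\tilde\Delta\|\le1$ and $\det(I-M\tilde\Delta)=0$; furthermore, there exists a nonzero nonnegative vector $q\in\mathbb R_+^m$ such that $q=M\tilde\Delta q$.
   Context: Fix integers $f,s\ge 0$, block sizes $m_1,\dots,m_{f+s}\ge1$ with $\sum_i m_i=m$, and a partition $\{1,\dots,f+s\}=\mathcal I_{\mathbb R}\cup\mathcal I_{\mathbb C}$ into disjoint sets. Let $\boldsymbol\Delta_{\mathbb{RC}}$ be the set of block diagonal matrices $\mathrm{diag}(\Delta_1,\dots,\Delta_f,\delta_{f+1}I_{m_{f+1}},\dots,\delta_{f+s}I_{m_{f+s}})$ where, for $i\le f$, $\Delta_i\in\mathbb R^{m_i\times m_i}$ if $i\in\mathcal I_{\mathbb R}$ and $\Delta_i\in\mathbb C^{m_i\times m_i}$ if $i\in\mathcal I_{\mathbb C}$; and for $f<i\le f+s$, $\delta_i\in\mathbb R$ if $i\in\mathcal I_{\mathbb R}$ and $\delta_i\in\mathbb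 C$ if $i\in\mathcal I_{\mathbb C}$. Here $\mathbb R_+=[0,\infty)$ and $\|\cdot\|$ is the spectral norm (largest singular value). For $A\in\mathbb C^{m\times m}$ and a set $\mathbf D\subset\mathbb C^{m\times m}$, the structured singular value is $$\mu(A,\mathbf D):=\frac1{\inf\{\|\Delta\|:\Delta\in\mathbf D,\ \det(I-A\Delta)=0\}},$$ with $\mu(A,\mathbf D)=0$ if no $\Delta\in\mathbf D$ satisfies $\det(I-A\Delta)=0$. *)

theory Defs
  imports
    "Jordan_Normal_Form.Matrix"
    "Jordan_Normal_Form.Determinant"
    "Jordan_Normal_Form.Char_Poly"
    "Jordan_Normal_Form.Schur_Decomposition"
    "HOL-Library.Nonpos_Ints"
begin

definition real_mat :: "nat \<Rightarrow> complex mat set" where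
  "real_mat m = {A \<in> carrier_mat m m. elements_mat A \<subseteq> \<real>}"

definition nonneg_mat :: "nat \<Rightarrow> complex mat set" where
  "nonneg_mat m = {A \<in> carrier_mat m m. elements_mat A \<subseteq> \<real>\<^sub>\<ge>\<^sub>0}"

definition nonneg_vec :: "nat \<Rightarrow> complex vec set" where
  "nonneg_vec m = {v \<in> carrier_vec m. \<forall>i<m. v $ i \<in> \<real>\<^sub>\<ge>\<^sub>0}"

definition singular_values :: "complex mat \<Rightarrow> real set" where
  "singular_values A =
    {\<sigma>. 0 \<le> \<sigma> \<and> eigenvalue (mat_adjoint A * A) (complex_of_real (\<sigma>\<^sup>2))}"

text \<open>A matrix without columns has no singular values in the above sense, so that
  \<^const>\<open>Max\<close> would be unspecified there; its norm is set to 0.\<close>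

definition spectral_norm :: "complex mat \<Rightarrow> real" where
  "spectral_norm A = (if dim_col A = 0 then 0 else Max (singular_values A))"

text \<open>If the set below is nonempty then its infimum is positive, because
  \<open>det (I - A * \<Delta>) = 0\<close> forces \<open>1 \<le> spectral_norm A * spectral_norm \<Delta>\<close>. Hence the
  value is always a finite real and the division is never a division by zero.\<close>

definition structured_singular_value :: "complex mat \<Rightarrow> complex mat set \<Rightarrow> real" where
  "structured_singular_value A D =
    (if \<exists>\<Delta>\<in>D. det (1\<^sub>m (dim_row A) - A * \<Delta>) = 0
     then 1 / Inf {spectral_norm \<Delta> | \<Delta>. \<Delta> \<in> D \<and> det (1\<^sub>m (dim_row A) - A * \<Delta>) = 0}
     else 0)"

text \<open>The structure with \<open>f\<close> full blocks (indices \<open>1..f\<close>) and \<open>s\<close> repeated scalar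
  blocks (indices \<open>f+1..f+s\<close>), where block \<open>i\<close> has size \<open>ms i\<close>; \<open>IR\<close> and \<open>IC\<close> hold
  the indices of the real and of the complex blocks.\<close>

definition Delta_RC ::
  "nat \<Rightarrow> nat \<Rightarrow> (nat \<Rightarrow> nat) \<Rightarrow> nat set \<Rightarrow> nat set \<Rightarrow> complex mat set" where
  "Delta_RC f s ms IR IC =
    {diag_block_mat (map \<Delta> [1..<f + 1] @ map (\<lambda>i. \<delta> i \<cdot>\<^sub>m 1\<^sub>m (ms i)) [f + 1..<f + s + 1])
      | \<Delta> \<delta>.
        (\<forall>i\<in>{1..f}. (i \<in> IR \<longrightarrow> \<Delta> i \<in> real_mat (ms i)) \<and>
                    (i \<in> IC \<longrightarrow> \<Delta> i \<in> carrier_mat (ms i) (ms i))) \<and>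
        (\<forall>i\<in>{f+1..f+s}. i \<in> IR \<longrightarrow> \<delta> i \<in> \<real>)}"

end

theory Submission
  imports Defs "HOL-Analysis.Function_Topology" "HOL-Analysis.L2_Norm"
begin

text \<open>Taking absolute values in \<open>x = M \<Delta> x\<close> with \<open>\<parallel>\<Delta>\<parallel> \<le> c\<close> gives \<open>x \<le> c M w\<close> with nonnegative \<open>x\<close>, \<open>w\<close>
  such that \<open>\<parallel>w\<^sub>k\<parallel> \<le> \<parallel>x\<^sub>k\<parallel>\<close> on the full blocks and \<open>w = x\<close> on the scalar blocks. A
  Collatz--Wielandt argument over all these pairs, i.e. maximising \<open>t\<close> subject to \<open>t x \<le> M w\<close>, yields
  equality \<open>t x = M w\<close> with \<open>t \<ge> 1\<close>; strict positivity of \<open>M\<close>, needed for the equality, is obtained by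
  perturbation and compactness. Since \<open>c > 1\<close> may be arbitrary, it does not matter whether the
  infimum in the structured singular value is attained. The full blocks
  \<open>w\<^sub>k x\<^sub>k\<^sup>T / (t \<parallel>x\<^sub>k\<parallel>\<^sup>2)\<close> and the scalar \<open>1 / t\<close> then form the required matrix, with \<open>q = x\<close>.\<close>

section \<open>A Collatz--Wielandt argument for block structured pairs\<close>

text \<open>Tychonoff's theorem, since the topology on functions is the product topology. It
  provides the compact sets for the extremal arguments, in which vectors are functions on
  \<open>nat\<close>.\<close>

lemma compact_coordinatewise:
  fixes S :: "'a \<Rightarrow> 'b :: topological_space set"
  assumes "\<And>i. compact (S i)"
  shows "compact {v. \<forall>i. v i \<in> S i}"
proof -
  have "compactin (product_topology (\<lambda>_. euclidean) UNIV) (Pi\<^sub>E UNIV S)"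
    using assms by (subst compactin_PiE) auto
  moreover have "Pi\<^sub>E UNIV S = {v. \<forall>i. v i \<in> S i}" by (auto simp: PiE_def Pi_def)
  ultimately show ?thesis by (simp add: euclidean_product_topology)
qed

lemma closed_Collect_ball:
  assumes "\<And>i. i \<in> I \<Longrightarrow> closed {x. P i x}"
  shows "closed {x. \<forall>i\<in>I. P i x}"
proof -
  have "{x. \<forall>i\<in>I. P i x} = (\<Inter>i\<in>I. {x. P i x})" by auto
  then show ?thesis using assms by auto
qed

lemma continuous_on_fst_apply: "continuous_on S (\<lambda>p. fst p i)"
  by (rule continuous_on_product_then_coordinatewise) (intro continuous_intros)

lemma continuous_on_snd_apply: "continuous_on S (\<lambda>p. snd p i)"
  by (rule continuous_on_product_then_coordinatewise) (intro continuous_intros)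

lemma continuous_on_fst_fst_apply: "continuous_on S (\<lambda>p. fst (fst p) i)"
  by (rule continuous_on_product_then_coordinatewise) (intro continuous_intros)

lemma continuous_on_snd_fst_apply: "continuous_on S (\<lambda>p. snd (fst p) i)"
  by (rule continuous_on_product_then_coordinatewise) (intro continuous_intros)

lemmas continuous_on_apply_intros =
  continuous_on_fst_apply continuous_on_snd_apply
  continuous_on_fst_fst_apply continuous_on_snd_fst_apply

text \<open>A pair \<open>(x, w)\<close> is admissible iff \<open>w = \<Delta> x\<close> for some nonnegative \<open>\<Delta>\<close> of norm at most 1 with
  full blocks \<open>k < f\<close> and identity blocks \<open>k \<ge> f\<close>, where \<open>b i\<close> is the block of the coordinate \<open>i\<close>.\<close>

definition admissible ::
  "nat \<Rightarrow> nat \<Rightarrow> (nat \<Rightarrow> nat) \<Rightarrow> (nat \<Rightarrow> real) \<Rightarrow> (nat \<Rightarrow> real) \<Rightarrow> bool" where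
  "admissible n f b x w \<longleftrightarrow>
     (\<forall>i<n. 0 \<le> x i \<and> 0 \<le> w i \<and> (f \<le> b i \<longrightarrow> w i = x i)) \<and>
     (\<forall>k<f. (\<Sum>i | i < n \<and> b i = k. (w i)\<^sup>2) \<le> (\<Sum>i | i < n \<and> b i = k. (x i)\<^sup>2))"

lemma admissible_scale:
  assumes "admissible n f b x w" "0 \<le> r"
    and "\<And>i. i < n \<Longrightarrow> x' i = r * x i" "\<And>i. i < n \<Longrightarrow> w' i = r * w i"
  shows "admissible n f b x' w'"
proof -
  have "(\<Sum>i | i < n \<and> b i = k. (w' i)\<^sup>2) \<le> (\<Sum>i | i < n \<and> b i = k. (x' i)\<^sup>2)" if "k < f" for k
  proof -
    have "(\<Sum>i | i < n \<and> b i = k. (w' i)\<^sup>2) = r\<^sup>2 * (\<Sum>i | i < n \<and> b i = k. (w i)\<^sup>2)"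
      using assms(4) by (auto simp: sum_distrib_left power_mult_distrib intro!: sum.cong)
    also have "\<dots> \<le> r\<^sup>2 * (\<Sum>i | i < n \<and> b i = k. (x i)\<^sup>2)"
      using assms(1) that by (intro mult_left_mono) (auto simp: admissible_def)
    also have "\<dots> = (\<Sum>i | i < n \<and> b i = k. (x' i)\<^sup>2)"
      using assms(3) by (auto simp: sum_distrib_left power_mult_distrib intro!: sum.cong)
    finally show ?thesis .
  qed
  then show ?thesis using assms by (auto simp: admissible_def)
qed

text \<open>The condition that \<open>x\<close> sums to 1 rules out \<open>x = 0\<close> and
  survives limits. Fixing the values from \<open>n\<close> on to be 0 is what lets a set of
  functions on all of \<open>nat\<close> be compact.\<close>

definition unit_pairs :: "nat \<Rightarrow> nat \<Rightarrow> (nat \<Rightarrow> nat) \<Rightarrow> ((nat \<Rightarrow> real) \<times> (nat \<Rightarrow> real)) set" where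
  "unit_pairs n f b = {(x, w). admissible n f b x w \<and> (\<Sum>i<n. x i) = 1 \<and>
     (\<forall>i\<ge>n. x i = 0 \<and> w i = 0)}"

text \<open>On a full block \<open>w i\<close> is at most the Euclidean norm of the block of
  \<open>x\<close>, whose entries are at most 1; \<open>n\<close> is a crude substitute for
  \<open>sqrt n\<close>.\<close>

lemma unit_pairs_bounds:
  assumes "(x, w) \<in> unit_pairs n f b" "i < n"
  shows "0 \<le> x i" "x i \<le> 1" "0 \<le> w i" "w i \<le> real n"
proof -
  have adm: "admissible n f b x w" and s: "(\<Sum>i<n. x i) = 1"
    using assms by (auto simp: unit_pairs_def)
  show nn: "0 \<le> x i" "0 \<le> w i" using adm assms by (auto simp: admissible_def)
  have le1: "x j \<le> 1" if "j < n" for j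
    using member_le_sum[of j "{..<n}" x] that adm s by (auto simp: admissible_def)
  then show "x i \<le> 1" using assms by auto
  show "w i \<le> real n"
  proof (cases "b i < f")
    case True
    have "(w i)\<^sup>2 \<le> (\<Sum>j | j < n \<and> b j = b i. (w j)\<^sup>2)"
      using assms(2) by (intro member_le_sum[of i _ "\<lambda>j. (w j)\<^sup>2"]) auto
    also have "\<dots> \<le> (\<Sum>j | j < n \<and> b j = b i. (x j)\<^sup>2)"
      using adm True by (auto simp: admissible_def)
    also have "\<dots> \<le> (\<Sum>j<n. (x j)\<^sup>2)" by (intro sum_mono2) auto
    also have "\<dots> \<le> (\<Sum>j<n. 1)"
      using le1 adm by (intro sum_mono power_le_one) (auto simp: admissible_def)
    also have "\<dots> \<le> (real n)\<^sup>2" using assms(2) by (simp add: power2_eq_square)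
    finally show ?thesis by (rule power2_le_imp_le) simp
  next
    case False
    then have "w i = x i" using adm assms by (auto simp: admissible_def)
    then show ?thesis using le1[OF assms(2)] assms(2) by linarith
  qed
qed

text \<open>The pairs lie in a product of compact intervals, and the remaining conditions are closed
  because each involves finitely many coordinates.\<close>

lemma compact_unit_pairs: "compact (unit_pairs n f b)"
proof -
  let ?S = "\<lambda>c i. if i < n then {0..c} else {0 :: real}"
  let ?K = "{x. \<forall>i. x i \<in> ?S 1 i} \<times> {w. \<forall>i. w i \<in> ?S (real n) i}"
  have "compact ?K" by (intro compact_Times compact_coordinatewise) auto
  moreover have "closed {p. (\<forall>i\<in>{i. i < n \<and> f \<le> b i}. snd p i = fst p i) \<and> (\<Sum>i<n. fst p i) = 1 \<and>
     (\<forall>k\<in>{..<f}. (\<Sum>i | i < n \<and> b i = k. (snd p i)\<^sup>2) \<le> (\<Sum>i | i < n \<and> b i = k. (fst p i :: real)\<^sup>2))}"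
    (is "closed ?C")
    by (intro closed_Collect_conj closed_Collect_ball closed_Collect_eq closed_Collect_le
        continuous_intros continuous_on_apply_intros)
  moreover have "unit_pairs n f b = ?K \<inter> ?C"
  proof (intro equalityI subsetI)
    fix p assume "p \<in> unit_pairs n f b"
    then obtain x w where p: "p = (x, w)" and a: "(x, w) \<in> unit_pairs n f b" by (cases p) auto
    have "x i \<in> ?S 1 i \<and> w i \<in> ?S (real n) i" for i
      using unit_pairs_bounds[OF a, of i] a by (auto simp: unit_pairs_def)
    then show "p \<in> ?K \<inter> ?C" using a by (auto simp: p unit_pairs_def admissible_def)
  next
    fix p assume "p \<in> ?K \<inter> ?C"
    then obtain x w where p: "p = (x, w)" and a: "(x, w) \<in> ?K" "(x, w) \<in> ?C" by (cases p) blast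
    have "x i \<in> ?S 1 i" "w i \<in> ?S (real n) i" for i using a(1) by auto
    then have "(i < n \<longrightarrow> 0 \<le> x i \<and> 0 \<le> w i) \<and> (n \<le> i \<longrightarrow> x i = 0 \<and> w i = 0)" for i
      by (metis atLeastAtMost_iff leD singletonD)
    then show "p \<in> unit_pairs n f b" using a(2) by (auto simp: p unit_pairs_def admissible_def)
  qed
  ultimately show ?thesis by (simp add: compact_Int_closed)
qed

lemma admissible_normalise:
  assumes "admissible n f b x w" "i < n" "x i \<noteq> 0"
  obtains x' w' r where "(x', w') \<in> unit_pairs n f b" "0 < r"
    "\<And>i. i < n \<Longrightarrow> x' i = r * x i" "\<And>i. i < n \<Longrightarrow> w' i = r * w i"
proof -
  define S where "S = (\<Sum>i<n. x i)"
  have nn: "\<And>j. j < n \<Longrightarrow> 0 \<le> x j" using assms by (auto simp: admissible_def)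
  have "0 < S" unfolding S_def
    using nn assms(2,3) by (intro sum_pos2[of _ i]) (auto simp: order_less_le)
  define x' where "x' = (\<lambda>j. if j < n then inverse S * x j else 0)"
  define w' where "w' = (\<lambda>j. if j < n then inverse S * w j else 0)"
  have "admissible n f b x' w'"
    using \<open>0 < S\<close> by (intro admissible_scale[OF assms(1), of "inverse S"]) (auto simp: x'_def w'_def)
  moreover have "(\<Sum>j<n. x' j) = inverse S * S"
    unfolding S_def sum_distrib_left by (simp add: x'_def S_def)
  ultimately have "(x', w') \<in> unit_pairs n f b"
    using \<open>0 < S\<close> by (auto simp: unit_pairs_def x'_def w'_def)
  then show ?thesis using that[of x' w' "inverse S"] \<open>0 < S\<close> by (simp add: x'_def w'_def)
qed

text \<open>Summing the inequalities over \<open>i\<close> turns the left side into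
  \<open>t\<close>, because \<open>x\<close> sums to 1. The bound keeps the set over which
  \<open>t\<close> is maximised compact.\<close>

lemma subeigen_bound:
  fixes a :: "nat \<Rightarrow> nat \<Rightarrow> real"
  assumes "\<And>i j. i < n \<Longrightarrow> j < n \<Longrightarrow> 0 \<le> a i j"
    and "(x, w) \<in> unit_pairs n f b" "\<And>i. i < n \<Longrightarrow> t * x i \<le> (\<Sum>j<n. a i j * w j)"
  shows "t \<le> (\<Sum>i<n. \<Sum>j<n. a i j * real n)"
proof -
  have "t = (\<Sum>i<n. t * x i)"
    using assms(2) by (auto simp: unit_pairs_def simp flip: sum_distrib_left)
  also have "\<dots> \<le> (\<Sum>i<n. \<Sum>j<n. a i j * w j)" using assms(3) by (intro sum_mono) auto
  also have "\<dots> \<le> (\<Sum>i<n. \<Sum>j<n. a i j * real n)"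
    using assms(1) unit_pairs_bounds(4)[OF assms(2)] by (intro sum_mono mult_left_mono) auto
  finally show ?thesis .
qed

text \<open>If the inequality \<open>t x \<le> a w\<close> is strict somewhere, then passing to \<open>x' = a w\<close> and a
  \<open>w' \<ge> t w\<close>, \<open>w' \<noteq> t w\<close> makes it strict everywhere, since \<open>a\<close> is positive.\<close>

lemma subeigen_improve:
  fixes a :: "nat \<Rightarrow> nat \<Rightarrow> real"
  assumes pos: "\<And>i j. i < n \<Longrightarrow> j < n \<Longrightarrow> 0 < a i j"
    and adm: "admissible n f b x w" and t: "0 \<le> t"
    and le: "\<And>i. i < n \<Longrightarrow> t * x i \<le> (\<Sum>j<n. a i j * w j)"
    and strict: "p < n" "t * x p < (\<Sum>j<n. a p j * w j)"
  obtains x' w' t' where "admissible n f b x' w'" "x' p \<noteq> 0" "t < t'"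
    "\<And>i. i < n \<Longrightarrow> t' * x' i \<le> (\<Sum>j<n. a i j * w' j)"
proof -
  define y where "y = (\<lambda>i. \<Sum>j<n. a i j * w j)"
  have nn: "\<And>i. i < n \<Longrightarrow> 0 \<le> x i" "\<And>i. i < n \<Longrightarrow> 0 \<le> w i"
    using adm by (auto simp: admissible_def)
  \<comment> \<open>If \<open>w\<close> vanished, strictness at \<open>p\<close> would read
    \<open>t * x p < 0\<close>, contrary to the signs.\<close>
  obtain q where q: "q < n" "w q > 0"
  proof (rule ccontr)
    assume "\<not> thesis"
    then have "\<forall>i<n. w i = 0" using that nn by (metis order_less_le)
    then have "(\<Sum>j<n. a p j * w j) = 0" by simp
    then show False using strict t nn(1)[of p] by (smt (verit) mult_nonneg_nonneg)
  qed
  have ypos: "0 < y i" if "i < n" for i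
    unfolding y_def
  proof (rule sum_pos2[of _ q])
    show "0 < a i q * w q" using pos[OF that] q by simp
    show "0 \<le> a i j * w j" if "j \<in> {..<n}" for j
      using pos[OF \<open>i < n\<close>, of j] nn that by simp
  qed (use q in auto)
  have yle: "t * x i \<le> y i" if "i < n" for i using le that by (simp add: y_def)
  let ?B = "{i. i < n \<and> b i = b p}"
  \<comment> \<open>The gap between the squared norms of \<open>y\<close> and \<open>t w\<close> on
    the block of \<open>p\<close>. On a full block it is positive: \<open>y\<close> exceeds
    \<open>t x\<close> strictly at \<open>p\<close>, and \<open>x\<close> dominates \<open>w\<close>
    in norm.\<close>
  define d where "d = (\<Sum>i\<in>?B. (y i)\<^sup>2) - (\<Sum>i\<in>?B. (t * w i)\<^sup>2)"
  have block: "(\<Sum>i | i < n \<and> b i = k. (t * w i)\<^sup>2) \<le> (\<Sum>i | i < n \<and> b i = k. (t * x i)\<^sup>2)"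
    if "k < f" for k
  proof -
    have "t\<^sup>2 * (\<Sum>i | i < n \<and> b i = k. (w i)\<^sup>2) \<le> t\<^sup>2 * (\<Sum>i | i < n \<and> b i = k. (x i)\<^sup>2)"
      using adm that by (intro mult_left_mono) (auto simp: admissible_def)
    then show ?thesis by (simp add: sum_distrib_left power_mult_distrib)
  qed
  have yblock: "(\<Sum>i | i < n \<and> b i = k. (t * x i)\<^sup>2) \<le> (\<Sum>i | i < n \<and> b i = k. (y i)\<^sup>2)" for k
    using yle nn t by (intro sum_mono power_mono) auto
  have d: "0 < d" if "b p < f"
  proof -
    have "(\<Sum>i\<in>?B. (t * x i)\<^sup>2) < (\<Sum>i\<in>?B. (y i)\<^sup>2)"
    proof (rule sum_strict_mono_ex1)
      show "\<forall>i\<in>?B. (t * x i)\<^sup>2 \<le> (y i)\<^sup>2"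
        using yle nn t by (auto intro!: power_mono)
      show "\<exists>i\<in>?B. (t * x i)\<^sup>2 < (y i)\<^sup>2"
        using strict nn t by (intro bexI[of _ p] power_strict_mono) (auto simp: y_def)
    qed simp
    then show ?thesis using block[OF that] by (simp add: d_def)
  qed
  \<comment> \<open>On scalar blocks admissibility forces \<open>w' = y\<close>. If the block of
    \<open>p\<close> is full, the whole gap \<open>d\<close> is spent on the coordinate
    \<open>p\<close>, so that \<open>w'\<close> and \<open>y\<close> have equal norm on this
    block.\<close>
  define w' where "w' = (\<lambda>i. if f \<le> b i then y i
    else if i = p then sqrt ((t * w i)\<^sup>2 + d) else t * w i)"
  have w'_ge: "t * w i \<le> w' i" if "i < n" for i
  proof -
    have "t * w i \<le> sqrt ((t * w i)\<^sup>2 + d)" if "b p < f"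
      using d[OF that] by (intro real_le_rsqrt) auto
    moreover have "t * w i \<le> y i" if "f \<le> b i"
      using yle[OF \<open>i < n\<close>] adm that \<open>i < n\<close> by (auto simp: admissible_def)
    ultimately show ?thesis by (auto simp: w'_def)
  qed
  have w'_gt: "t * w p < w' p"
  proof (cases "f \<le> b p")
    case True
    then show ?thesis using adm strict by (auto simp: w'_def admissible_def y_def)
  next
    case False
    then show ?thesis using d by (auto simp: w'_def intro!: real_less_rsqrt)
  qed
  have w'_nn: "0 \<le> w' i" if "i < n" for i
    using w'_ge[OF that] t nn(2)[OF that] by (smt (verit) mult_nonneg_nonneg)
  have "(\<Sum>i | i < n \<and> b i = k. (w' i)\<^sup>2) \<le> (\<Sum>i | i < n \<and> b i = k. (y i)\<^sup>2)" if "k < f" for k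
  proof (cases "k = b p")
    case True
    have "(\<Sum>i\<in>?B. (w' i)\<^sup>2) = (w' p)\<^sup>2 + (\<Sum>i\<in>?B - {p}. (w' i)\<^sup>2)"
      using strict by (intro sum.remove) auto
    also have "(w' p)\<^sup>2 = (t * w p)\<^sup>2 + d"
      using d True that by (auto simp: w'_def)
    also have "(\<Sum>i\<in>?B - {p}. (w' i)\<^sup>2) = (\<Sum>i\<in>?B - {p}. (t * w i)\<^sup>2)"
      using True that by (intro sum.cong) (auto simp: w'_def)
    also have "(t * w p)\<^sup>2 + d + \<dots> = d + (\<Sum>i\<in>?B. (t * w i)\<^sup>2)"
      using strict by (subst sum.remove[of ?B p]) auto
    also have "\<dots> = (\<Sum>i\<in>?B. (y i)\<^sup>2)" by (simp add: d_def)
    finally show ?thesis using True by simp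
  next
    case False
    then have "(\<Sum>i | i < n \<and> b i = k. (w' i)\<^sup>2) = (\<Sum>i | i < n \<and> b i = k. (t * w i)\<^sup>2)"
      using that by (intro sum.cong) (auto simp: w'_def)
    then show ?thesis using block[OF that] yblock[of k] by linarith
  qed
  then have adm': "admissible n f b y w'"
    using ypos w'_nn by (auto simp: admissible_def less_imp_le w'_def)
  have gt: "t * y i < (\<Sum>j<n. a i j * w' j)" if "i < n" for i
  proof -
    have "t * y i = (\<Sum>j<n. a i j * (t * w j))"
      by (simp add: y_def sum_distrib_left ac_simps)
    also have "\<dots> < (\<Sum>j<n. a i j * w' j)"
      using pos[OF that] w'_ge w'_gt strict
      by (intro sum_strict_mono_ex1) (auto intro!: mult_left_mono less_imp_le bexI[of _ p])
    finally show ?thesis .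
  qed
  \<comment> \<open>The Collatz-Wielandt quotient: the largest factor feasible for
    \<open>(y, w')\<close>. Strictness in all of the finitely many rows puts it above
    \<open>t\<close>.\<close>
  define t' where "t' = Min ((\<lambda>i. (\<Sum>j<n. a i j * w' j) / y i) ` {..<n})"
  have "t < t'"
    unfolding t'_def using gt ypos strict by (subst Min_gr_iff) (auto simp: field_simps)
  moreover have "t' * y i \<le> (\<Sum>j<n. a i j * w' j)" if "i < n" for i
  proof -
    have "t' \<le> (\<Sum>j<n. a i j * w' j) / y i" unfolding t'_def using that by (intro Min_le) auto
    then show ?thesis using ypos[OF that] by (simp add: field_simps)
  qed
  ultimately show ?thesis using that[OF adm'] ypos[OF strict(1)] by simp
qed

text \<open>A maximal \<open>t\<close> exists by compactness. A strict inequality in any row would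
  allow a larger \<open>t\<close> by \<open>subeigen_improve\<close>, so equality holds; the
  hypothesis makes every \<open>1 / c\<close> with \<open>c > 1\<close> feasible, so the maximum is
  at least 1.\<close>

lemma positive_eigenpair:
  fixes a :: "nat \<Rightarrow> nat \<Rightarrow> real"
  assumes pos: "\<And>i j. i < n \<Longrightarrow> j < n \<Longrightarrow> 0 < a i j"
    and sub: "\<And>c. c > 1 \<Longrightarrow> \<exists>x w. admissible n f b x w \<and> (\<exists>i<n. x i \<noteq> 0) \<and>
           (\<forall>i<n. x i \<le> c * (\<Sum>j<n. a i j * w j))"
  obtains x w t where "(x, w) \<in> unit_pairs n f b" "1 \<le> t"
    "\<And>i. i < n \<Longrightarrow> t * x i = (\<Sum>j<n. a i j * w j)"
proof -
  let ?C = "\<Sum>i<n. \<Sum>j<n. a i j * real n"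
  \<comment> \<open>The range of \<open>t\<close> is cut off at \<open>?C\<close> for compactness;
    by \<open>subeigen_bound\<close> no feasible nonnegative \<open>t\<close> is lost.\<close>
  define P where "P = unit_pairs n f b \<times> {0..?C} \<inter>
     {p. \<forall>i\<in>{..<n}. snd p * fst (fst p) i \<le> (\<Sum>j<n. a i j * snd (fst p) j)}"
  have P_iff: "((x, w), t) \<in> P \<longleftrightarrow> (x, w) \<in> unit_pairs n f b \<and> 0 \<le> t \<and>
      (\<forall>i<n. t * x i \<le> (\<Sum>j<n. a i j * w j))" for x w t
    using subeigen_bound[of n a x w f b t] pos by (auto simp: P_def less_imp_le)
  have feasible: "\<exists>y v. ((y, v), t) \<in> P"
    if feas: "admissible n f b x w" "p < n" "x p \<noteq> 0" "0 \<le> t"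
      "\<And>i. i < n \<Longrightarrow> t * x i \<le> (\<Sum>j<n. a i j * w j)" for x w t p
  proof -
    obtain x' w' r where r: "(x', w') \<in> unit_pairs n f b" "0 < r"
      "\<And>i. i < n \<Longrightarrow> x' i = r * x i" "\<And>i. i < n \<Longrightarrow> w' i = r * w i"
      using admissible_normalise[OF feas(1-3)] by blast
    have "t * x' i \<le> (\<Sum>j<n. a i j * w' j)" if "i < n" for i
    proof -
      have "r * (t * x i) \<le> r * (\<Sum>j<n. a i j * w j)"
        using feas(5) that r by (intro mult_left_mono) auto
      also have "\<dots> = (\<Sum>j<n. a i j * w' j)"
        using r by (auto simp: sum_distrib_left ac_simps intro!: sum.cong)
      finally show ?thesis using r that by (simp add: ac_simps)
    qed
    then have "((x', w'), t) \<in> P" unfolding P_iff using r(1) feas(4) by blast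
    then show ?thesis by blast
  qed
  have feasible_inverse: "\<exists>y v. ((y, v), inverse c) \<in> P" if c: "c > 1" for c
  proof -
    obtain x w p where xw: "admissible n f b x w" "p < n" "x p \<noteq> 0"
      "\<forall>i<n. x i \<le> c * (\<Sum>j<n. a i j * w j)" using sub[OF c] by blast
    show ?thesis
      using c xw(4) by (intro feasible[OF xw(1-3)]) (auto simp: field_simps)
  qed
  have "compact P" unfolding P_def
    by (intro compact_Int_closed compact_Times compact_unit_pairs closed_Collect_ball
        closed_Collect_le continuous_intros continuous_on_apply_intros compact_Icc)
  moreover have "P \<noteq> {}" using feasible_inverse[of 2] by auto
  moreover have "continuous_on P snd" by (intro continuous_intros)
  ultimately obtain m where m: "m \<in> P" "\<forall>p\<in>P. snd p \<le> snd m"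
    using continuous_attains_sup by blast
  obtain x w t where xwt: "m = ((x, w), t)" by (metis surj_pair)
  have mem: "(x, w) \<in> unit_pairs n f b" "0 \<le> t"
    "\<And>i. i < n \<Longrightarrow> t * x i \<le> (\<Sum>j<n. a i j * w j)"
    using m(1) by (auto simp: xwt P_iff)
  have max: "t' \<le> t" if "((y, v), t') \<in> P" for y v t' using m(2) that by (auto simp: xwt)
  have "1 \<le> t"
  proof (rule ccontr)
    assume "\<not> 1 \<le> t"
    \<comment> \<open>For \<open>c = 1 / s > 1\<close> the feasible value \<open>1 / c = s\<close>
      would exceed the maximum \<open>t\<close>.\<close>
    then obtain s where s: "t < s" "s < 1" using dense[of t 1] by auto
    with mem(2) have "1 < inverse s" by (intro one_less_inverse) auto
    from feasible_inverse[OF this] max s show False by force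
  qed
  moreover have "t * x i = (\<Sum>j<n. a i j * w j)" if i: "i < n" for i
  proof (rule ccontr)
    assume "t * x i \<noteq> (\<Sum>j<n. a i j * w j)"
    then have "t * x i < (\<Sum>j<n. a i j * w j)" using mem(3)[OF i] by simp
    moreover have "admissible n f b x w" using mem(1) by (auto simp: unit_pairs_def)
    ultimately obtain x' w' t' where better: "admissible n f b x' w'" "x' i \<noteq> 0" "t < t'"
        "\<And>i. i < n \<Longrightarrow> t' * x' i \<le> (\<Sum>j<n. a i j * w' j)"
      using subeigen_improve[of n a f b x w t i] pos mem i by blast
    with feasible[OF better(1) i better(2), of t'] mem(2) max show False by force
  qed
  ultimately show ?thesis using that mem(1) by blast
qed

text \<open>The limit \<open>e \<rightarrow> 0\<close> of the perturbed matrices \<open>a + e\<close> is taken by minimising \<open>e\<close> over the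
  compact set of all normalised solutions.\<close>

lemma nonneg_eigenpair:
  fixes a :: "nat \<Rightarrow> nat \<Rightarrow> real"
  assumes nonneg: "\<And>i j. i < n \<Longrightarrow> j < n \<Longrightarrow> 0 \<le> a i j"
    and sub: "\<And>c. c > 1 \<Longrightarrow> \<exists>x w. admissible n f b x w \<and> (\<exists>i<n. x i \<noteq> 0) \<and>
           (\<forall>i<n. x i \<le> c * (\<Sum>j<n. a i j * w j))"
  obtains x w t where "admissible n f b x w" "\<exists>i<n. x i \<noteq> 0" "1 \<le> t"
    "\<And>i. i < n \<Longrightarrow> t * x i = (\<Sum>j<n. a i j * w j)"
proof -
  \<comment> \<open>Bounds the factors for all perturbations \<open>e \<le> 1\<close> at
    once.\<close>
  let ?C = "\<Sum>i<n. \<Sum>j<n. (a i j + 1) * real n"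
  define P where "P = unit_pairs n f b \<times> ({1..?C} \<times> {0..1}) \<inter>
     {p. \<forall>i\<in>{..<n}. fst (snd p) * fst (fst p) i = (\<Sum>j<n. (a i j + snd (snd p)) * snd (fst p) j)}"
  have ex: "\<exists>z t. (z, t, e) \<in> P" if e: "0 < e" "e \<le> 1" for e
  proof -
    have pos: "0 < a i j + e" if "i < n" "j < n" for i j using nonneg[OF that] e by simp
    \<comment> \<open>Adding \<open>e\<close> can only enlarge the right-hand side, as
      \<open>w\<close> is nonnegative, so the hypothesis passes to the perturbed matrix.\<close>
    have sub': "\<exists>x w. admissible n f b x w \<and> (\<exists>i<n. x i \<noteq> 0) \<and>
         (\<forall>i<n. x i \<le> c * (\<Sum>j<n. (a i j + e) * w j))" if c: "1 < c" for c
    proof -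
      obtain x w p where xw: "admissible n f b x w" "p < n" "x p \<noteq> 0"
        "\<forall>i<n. x i \<le> c * (\<Sum>j<n. a i j * w j)" using sub[OF c] by blast
      have "x i \<le> c * (\<Sum>j<n. (a i j + e) * w j)" if "i < n" for i
      proof -
        have "(\<Sum>j<n. a i j * w j) \<le> (\<Sum>j<n. (a i j + e) * w j)"
          using xw(1) e by (intro sum_mono mult_right_mono) (auto simp: admissible_def)
        then have "c * (\<Sum>j<n. a i j * w j) \<le> c * (\<Sum>j<n. (a i j + e) * w j)"
          using c by (intro mult_left_mono) auto
        then show ?thesis using xw(4) that by force
      qed
      then show ?thesis using xw by blast
    qed
    obtain x w t where xwt: "(x, w) \<in> unit_pairs n f b" "1 \<le> t"
      "\<And>i. i < n \<Longrightarrow> t * x i = (\<Sum>j<n. (a i j + e) * w j)"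
      using positive_eigenpair[of n "\<lambda>i j. a i j + e" f b, OF pos sub'] by blast
    have "t \<le> (\<Sum>i<n. \<Sum>j<n. (a i j + e) * real n)"
      using xwt nonneg e by (intro subeigen_bound) auto
    also have "\<dots> \<le> ?C" using e by (intro sum_mono mult_right_mono) auto
    finally have "((x, w), t, e) \<in> P" using xwt e by (auto simp: P_def)
    then show ?thesis by blast
  qed
  have "compact P" unfolding P_def
    by (intro compact_Int_closed compact_Times compact_unit_pairs closed_Collect_ball
        closed_Collect_eq continuous_intros continuous_on_apply_intros compact_Icc)
  moreover have "P \<noteq> {}" using ex[of 1] by auto
  moreover have "continuous_on P (\<lambda>p. snd (snd p))" by (intro continuous_intros)
  ultimately obtain m where m: "m \<in> P" "\<forall>p\<in>P. snd (snd m) \<le> snd (snd p)"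
    using continuous_attains_inf[of P "\<lambda>p. snd (snd p)"] by blast
  obtain x w t e where xwte: "m = ((x, w), t, e)" by (metis surj_pair)
  \<comment> \<open>Every \<open>e\<close> with \<open>0 < e \<le> 1\<close> occurs in
    \<open>P\<close>, so a positive minimum could be halved.\<close>
  have "e = 0"
  proof (rule ccontr)
    assume "e \<noteq> 0"
    then have "0 < e / 2" "e / 2 \<le> 1" using m(1) by (auto simp: xwte P_def)
    from ex[OF this] m(2) \<open>0 < e / 2\<close> show False by (force simp: xwte)
  qed
  then have *: "(x, w) \<in> unit_pairs n f b" "1 \<le> t" "\<And>i. i < n \<Longrightarrow> t * x i = (\<Sum>j<n. a i j * w j)"
    using m(1) by (auto simp: xwte P_def)
  have "\<exists>i<n. x i \<noteq> 0"
  proof (rule ccontr)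
    assume "\<not> (\<exists>i<n. x i \<noteq> 0)"
    then have "(\<Sum>i<n. x i) = 0" by simp
    then show False using *(1) by (simp add: unit_pairs_def)
  qed
  then show ?thesis using that[of x w t] * by (auto simp: unit_pairs_def)
qed

section \<open>The spectral norm as an operator norm\<close>

lemma mat_adjoint_carrier: "A \<in> carrier_mat n k \<Longrightarrow> mat_adjoint A \<in> carrier_mat k n"
  using mat_of_rows_carrier(1)[of "dim_row A" "map conjugate (cols A)"]
  by (simp add: mat_adjoint_def)

lemma mat_adjoint_index:
  "\<lbrakk>i < dim_col A; j < dim_row A\<rbrakk> \<Longrightarrow> mat_adjoint A $$ (i, j) = conjugate (A $$ (j, i))"
  by (simp add: mat_adjoint_def mat_of_rows_def)

lemma mult_mat_vec_index_sum:
  assumes "A \<in> carrier_mat n k" "v \<in> carrier_vec k" "i < n"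
  shows "(A *\<^sub>v v) $ i = (\<Sum>j<k. A $$ (i, j) * v $ j)"
  using assms by (simp add: scalar_prod_def lessThan_atLeast0)

definition sqnorm :: "complex vec \<Rightarrow> real" where
  "sqnorm v = (\<Sum>i<dim_vec v. (cmod (v $ i))\<^sup>2)"

lemma sqnorm_nonneg: "0 \<le> sqnorm v"
  by (auto simp: sqnorm_def intro: sum_nonneg)

lemma sqnorm_eq_0_iff: "v \<in> carrier_vec n \<Longrightarrow> sqnorm v = 0 \<longleftrightarrow> v = 0\<^sub>v n"
  by (auto simp: sqnorm_def sum_nonneg_eq_0_iff intro!: eq_vecI)

lemma sqnorm_smult: "sqnorm (c \<cdot>\<^sub>v v) = (cmod c)\<^sup>2 * sqnorm v"
  by (auto simp: sqnorm_def norm_mult power_mult_distrib sum_distrib_left)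

lemma sqnorm_add_smult:
  assumes "u \<in> carrier_vec n" "v \<in> carrier_vec n"
  shows "sqnorm (u + complex_of_real t \<cdot>\<^sub>v v) =
    sqnorm u + 2 * t * Re (\<Sum>i<n. u $ i * cnj (v $ i)) + t\<^sup>2 * sqnorm v"
proof -
  have "(cmod (u $ i + complex_of_real t * v $ i))\<^sup>2 =
      (cmod (u $ i))\<^sup>2 + 2 * t * Re (u $ i * cnj (v $ i)) + t\<^sup>2 * (cmod (v $ i))\<^sup>2" for i
    by (simp add: cmod_power2) (simp add: power2_eq_square algebra_simps)
  then show ?thesis
    using assms by (simp add: sqnorm_def sum.distrib sum_distrib_left Re_sum distrib_left)
qed

lemma adjoint_inner:
  assumes A: "A \<in> carrier_mat n n" and u: "u \<in> carrier_vec n" and v: "v \<in> carrier_vec n"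
  shows "(\<Sum>i<n. ((mat_adjoint A * A) *\<^sub>v u) $ i * cnj (v $ i)) =
    (\<Sum>i<n. (A *\<^sub>v u) $ i * cnj ((A *\<^sub>v v) $ i))"
proof -
  have Au: "A *\<^sub>v u \<in> carrier_vec n" using A u by simp
  have "(mat_adjoint A * A) *\<^sub>v u = mat_adjoint A *\<^sub>v (A *\<^sub>v u)"
    using mat_adjoint_carrier[OF A] A u by (intro assoc_mult_mat_vec)
  then have "(\<Sum>j<n. ((mat_adjoint A * A) *\<^sub>v u) $ j * cnj (v $ j)) =
      (\<Sum>j<n. (\<Sum>i<n. cnj (A $$ (i, j)) * (A *\<^sub>v u) $ i) * cnj (v $ j))"
    using A mult_mat_vec_index_sum[OF mat_adjoint_carrier[OF A] Au]
    by (auto simp: mat_adjoint_index intro!: sum.cong)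
  also have "\<dots> = (\<Sum>i<n. \<Sum>j<n. cnj (A $$ (i, j)) * (A *\<^sub>v u) $ i * cnj (v $ j))"
    by (subst sum.swap) (simp add: sum_distrib_right)
  also have "\<dots> = (\<Sum>i<n. (A *\<^sub>v u) $ i * cnj ((A *\<^sub>v v) $ i))"
    by (intro sum.cong refl)
      (simp add: mult_mat_vec_index_sum[OF A v] sum_distrib_left ac_simps del: index_mult_mat_vec)
  finally show ?thesis .
qed

lemma inner_self_sqnorm:
  "v \<in> carrier_vec n \<Longrightarrow> (\<Sum>i<n. v $ i * cnj (v $ i)) = complex_of_real (sqnorm v)"
  by (simp only: sqnorm_def carrier_vecD of_real_sum complex_norm_square)

text \<open>The squares are roots of a nonzero characteristic polynomial, and squaring is injective
  on nonnegative reals. Finiteness gives \<open>Max\<close> its meaning in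
  \<open>spectral_norm\<close>.\<close>

lemma finite_singular_values:
  assumes A: "A \<in> carrier_mat n n"
  shows "finite (singular_values A)"
proof -
  have H: "mat_adjoint A * A \<in> carrier_mat n n" using A mat_adjoint_carrier[OF A] by simp
  let ?p = "char_poly (mat_adjoint A * A)"
  have "?p \<noteq> 0" using degree_monic_char_poly[OF H] by auto
  then have "finite {x. poly ?p x = 0}" by (rule poly_roots_finite)
  then have "finite ((\<lambda>\<sigma>. complex_of_real (\<sigma>\<^sup>2)) -` {x. poly ?p x = 0} \<inter> {0..})"
    by (rule finite_vimage_IntI) (auto simp: inj_on_def simp del: of_real_power)
  moreover have "singular_values A \<subseteq> (\<lambda>\<sigma>. complex_of_real (\<sigma>\<^sup>2)) -` {x. poly ?p x = 0} \<inter> {0..}"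
    by (auto simp: singular_values_def eigenvalue_root_char_poly[OF H])
  ultimately show ?thesis by (rule rev_finite_subset)
qed

text \<open>The unit sphere, modelled by functions vanishing from \<open>n\<close> on, is compact,
  and \<open>g\<close> is continuous on it. Other nonzero vectors are scaled to norm 1.\<close>

lemma exists_sqnorm_maximiser:
  assumes A: "A \<in> carrier_mat n n" and n: "0 < n"
  obtains z where "z \<in> carrier_vec n" "sqnorm z = 1"
    "\<And>v. v \<in> carrier_vec n \<Longrightarrow> sqnorm (A *\<^sub>v v) \<le> sqnorm (A *\<^sub>v z) * sqnorm v"
proof -
  \<comment> \<open>A compact square containing the closed unit disc, hence every coordinate of a
    unit vector.\<close>
  define box where "box = (\<lambda>p. Complex (fst p) (snd p)) ` ({-1..1} \<times> {-1..1})"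
  have box_iff: "z \<in> box \<longleftrightarrow> \<bar>Re z\<bar> \<le> 1 \<and> \<bar>Im z\<bar> \<le> 1" for z
    unfolding box_def abs_le_iff by (cases z) (force simp: image_iff)
  define K where "K = {z. \<forall>i. z i \<in> (if i < n then box else {0})} \<inter> {z. (\<Sum>i<n. (cmod (z i))\<^sup>2) = 1}"
  define g where "g = (\<lambda>z. \<Sum>i<n. (cmod (\<Sum>j<n. A $$ (i, j) * z j))\<^sup>2)"
  have g: "sqnorm (A *\<^sub>v v) = g (\<lambda>i. v $ i)" if "v \<in> carrier_vec n" for v
    using A that by (auto simp: sqnorm_def g_def mult_mat_vec_index_sum[OF A that]
        simp del: index_mult_mat_vec)
  have coord: "continuous_on S (\<lambda>z. z i :: complex)" for S i
    by (rule continuous_on_product_then_coordinatewise) (intro continuous_intros)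
  have "continuous_on ({-1..1} \<times> {-1..1}) (\<lambda>p. Complex (fst p) (snd p))"
    by (simp add: Complex_eq) (intro continuous_intros)
  then have "compact box" unfolding box_def
    by (intro compact_continuous_image compact_Times compact_Icc)
  then have "compact K" unfolding K_def
    by (intro compact_Int_closed compact_coordinatewise closed_Collect_eq continuous_intros coord) auto
  moreover have "K \<noteq> {}"
  proof -
    let ?e = "\<lambda>i. if i = 0 then 1 else 0 :: complex"
    have "1 \<in> box" "0 \<in> box" by (simp_all add: box_iff)
    moreover have "(\<Sum>i<n. (cmod (?e i))\<^sup>2) = (\<Sum>i<n. if i = 0 then 1 else 0)"
      by (intro sum.cong) auto
    ultimately have "?e \<in> K" using n by (simp add: K_def)
    then show ?thesis by blast
  qed
  moreover have "continuous_on K g" unfolding g_def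
    by (intro continuous_intros coord)
  ultimately obtain z where z: "z \<in> K" "\<forall>v\<in>K. g v \<le> g z"
    using continuous_attains_sup[of K g] by blast
  have gz: "g (\<lambda>i. vec n z $ i) = g z" by (simp add: g_def)
  have unit: "g (\<lambda>i. v $ i) \<le> g z" if v: "v \<in> carrier_vec n" "sqnorm v = 1" for v
  proof -
    have "cmod (v $ i) \<le> 1" if "i < n" for i
    proof -
      have "(cmod (v $ i))\<^sup>2 \<le> (\<Sum>i<n. (cmod (v $ i))\<^sup>2)"
        using that by (intro member_le_sum) auto
      then show ?thesis using v by (auto simp: sqnorm_def power2_le_imp_le abs_square_le_1[symmetric])
    qed
    then have "v $ i \<in> box" if "i < n" for i
      using that abs_Re_le_cmod[of "v $ i"] abs_Im_le_cmod[of "v $ i"]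
      unfolding box_iff by (meson order_trans)
    then have "(\<lambda>i. if i < n then v $ i else 0) \<in> K"
      using v by (auto simp: K_def sqnorm_def)
    then have "g (\<lambda>i. if i < n then v $ i else 0) \<le> g z" using z by auto
    then show ?thesis by (simp add: g_def)
  qed
  show ?thesis
  proof
    show "vec n z \<in> carrier_vec n" by simp
    show "sqnorm (vec n z) = 1" using z(1) by (auto simp: sqnorm_def K_def)
    fix v :: "complex vec" assume v: "v \<in> carrier_vec n"
    show "sqnorm (A *\<^sub>v v) \<le> sqnorm (A *\<^sub>v vec n z) * sqnorm v"
    proof (cases "sqnorm v = 0")
      case True
      then have "v = 0\<^sub>v n" using sqnorm_eq_0_iff[OF v] by simp
      then have "A *\<^sub>v v = 0\<^sub>v n" using A by auto
      then show ?thesis by (simp add: True) (simp add: sqnorm_def)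
    next
      case False
      then have pos: "0 < sqnorm v" using sqnorm_nonneg[of v] by simp
      define c where "c = complex_of_real (inverse (sqrt (sqnorm v)))"
      have c: "(cmod c)\<^sup>2 = inverse (sqnorm v)"
        using pos by (simp add: c_def norm_inverse power_inverse del: of_real_inverse)
      have "sqnorm (c \<cdot>\<^sub>v v) = 1" using pos by (simp add: sqnorm_smult c)
      then have "sqnorm (A *\<^sub>v (c \<cdot>\<^sub>v v)) \<le> sqnorm (A *\<^sub>v vec n z)"
        using unit[of "c \<cdot>\<^sub>v v"] v g[of "c \<cdot>\<^sub>v v"] g[of "vec n z"] gz by simp
      moreover have "A *\<^sub>v (c \<cdot>\<^sub>v v) = c \<cdot>\<^sub>v (A *\<^sub>v v)" using A v by (rule mult_mat_vec)
      ultimately show ?thesis using pos by (simp add: sqnorm_smult c field_simps)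
    qed
  qed
qed

text \<open>For nonzero \<open>s\<close> the linear term wins near \<open>t = 0\<close>: at
  \<open>t = - s / d\<close> with \<open>d = \<bar>c\<bar> + 1\<close> the quadratic is at most
  \<open>- (s^2 / d)\<close>. The summand 1 keeps \<open>d\<close> positive when
  \<open>c = 0\<close>.\<close>

lemma eq_0_if_quadratic_nonneg:
  fixes s c :: real
  assumes "\<And>t. 0 \<le> 2 * t * s + t\<^sup>2 * c" "0 \<le> s"
  shows "s = 0"
proof (rule ccontr)
  assume "s \<noteq> 0"
  define d where "d = \<bar>c\<bar> + 1"
  have d: "0 < d" "c \<le> d" by (auto simp: d_def)
  have "0 \<le> 2 * (- s / d) * s + (- s / d)\<^sup>2 * c" by (rule assms)
  also have "\<dots> \<le> 2 * (- s / d) * s + (- s / d)\<^sup>2 * d"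
    using d by (intro add_left_mono mult_left_mono) auto
  also have "\<dots> = - (s\<^sup>2 / d)" using d by (simp add: power2_eq_square field_simps)
  also have "\<dots> < 0" using \<open>s \<noteq> 0\<close> d by simp
  finally show False by simp
qed

text \<open>At a maximiser \<open>z\<close> the quadratic form \<open>L |v|\<^sup>2 - |A v|\<^sup>2\<close> is nonnegative and vanishes, so
  varying \<open>z\<close> in the direction \<open>p = L z - A\<^sup>* A z\<close> forces \<open>p = 0\<close>.\<close>

lemma exists_max_singular_value:
  assumes A: "A \<in> carrier_mat n n" and n: "0 < n"
  obtains \<sigma> where "\<sigma> \<in> singular_values A"
    "\<And>v. v \<in> carrier_vec n \<Longrightarrow> sqnorm (A *\<^sub>v v) \<le> \<sigma>\<^sup>2 * sqnorm v"
proof -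
  obtain z where z: "z \<in> carrier_vec n" "sqnorm z = 1"
    "\<And>v. v \<in> carrier_vec n \<Longrightarrow> sqnorm (A *\<^sub>v v) \<le> sqnorm (A *\<^sub>v z) * sqnorm v"
    using exists_sqnorm_maximiser[OF A n] by blast
  define L where "L = sqnorm (A *\<^sub>v z)"
  define H where "H = mat_adjoint A * A"
  have H: "H \<in> carrier_mat n n" using A mat_adjoint_carrier[OF A] by (simp add: H_def)
  define p where "p = complex_of_real L \<cdot>\<^sub>v z - H *\<^sub>v z"
  have p: "p \<in> carrier_vec n" using z H by (simp add: p_def)
  have Hz: "H *\<^sub>v z \<in> carrier_vec n" using z H by simp
  let ?ip = "\<lambda>u v. \<Sum>i<n. u $ i * cnj (v $ i)"
  have p_index: "p $ i = complex_of_real L * z $ i - (H *\<^sub>v z) $ i" if "i < n" for i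
    using that z(1) H by (simp add: p_def del: index_mult_mat_vec)
  have "p $ i * c = complex_of_real L * (z $ i * c) - (H *\<^sub>v z) $ i * c" if "i < n" for i c
    unfolding p_index[OF that] by (simp add: left_diff_distrib)
  then have "?ip p p = (\<Sum>i<n. complex_of_real L * (z $ i * cnj (p $ i)) - (H *\<^sub>v z) $ i * cnj (p $ i))"
    by (intro sum.cong refl) (simp only: lessThan_iff)
  also have "\<dots> = L * ?ip z p - ?ip (H *\<^sub>v z) p"
    by (simp only: sum_subtractf sum_distrib_left)
  also have "?ip (H *\<^sub>v z) p = ?ip (A *\<^sub>v z) (A *\<^sub>v p)"
    unfolding H_def using A z(1) p by (rule adjoint_inner)
  finally have "complex_of_real (sqnorm p) = L * ?ip z p - ?ip (A *\<^sub>v z) (A *\<^sub>v p)"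
    by (simp only: inner_self_sqnorm[OF p])
  then have "Re (complex_of_real (sqnorm p)) = Re (L * ?ip z p - ?ip (A *\<^sub>v z) (A *\<^sub>v p))" by simp
  then have ipp: "sqnorm p = L * Re (?ip z p) - Re (?ip (A *\<^sub>v z) (A *\<^sub>v p))" by simp
  \<comment> \<open>Expand \<open>L * sqnorm v - sqnorm (A v)\<close> at \<open>v = z + t p\<close>.
    The constant terms cancel since \<open>sqnorm z = 1\<close>, and by the formula for
    \<open>sqnorm p\<close> the linear coefficient is \<open>2 * sqnorm p\<close>.\<close>
  have "0 \<le> 2 * t * sqnorm p + t\<^sup>2 * (L * sqnorm p - sqnorm (A *\<^sub>v p))" for t
  proof -
    let ?v = "z + complex_of_real t \<cdot>\<^sub>v p"
    have "sqnorm (A *\<^sub>v ?v) \<le> L * sqnorm ?v" unfolding L_def using z p by (intro z(3)) auto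
    moreover have "A *\<^sub>v ?v = A *\<^sub>v z + complex_of_real t \<cdot>\<^sub>v (A *\<^sub>v p)"
      using A z p by (simp add: mult_add_distrib_mat_vec[OF A] mult_mat_vec[OF A p])
    ultimately have "sqnorm (A *\<^sub>v z) + 2 * t * Re (?ip (A *\<^sub>v z) (A *\<^sub>v p)) + t\<^sup>2 * sqnorm (A *\<^sub>v p)
        \<le> L * (sqnorm z + 2 * t * Re (?ip z p) + t\<^sup>2 * sqnorm p)"
      using A z p by (simp only: sqnorm_add_smult[of _ n] mult_mat_vec_carrier)
    then show ?thesis unfolding L_def[symmetric] z(2) ipp by (simp add: algebra_simps)
  qed
  then have "sqnorm p = 0" using sqnorm_nonneg by (rule eq_0_if_quadratic_nonneg)
  then have p0: "p = 0\<^sub>v n" using sqnorm_eq_0_iff[OF p] by simp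
  have "H *\<^sub>v z = complex_of_real L \<cdot>\<^sub>v z"
  proof (rule eq_vecI)
    show "dim_vec (H *\<^sub>v z) = dim_vec (complex_of_real L \<cdot>\<^sub>v z)"
      using carrier_vecD[OF Hz] carrier_vecD[OF z(1)] by (simp only: index_smult_vec)
    fix i assume "i < dim_vec (complex_of_real L \<cdot>\<^sub>v z)"
    then have i: "i < n" using z(1) by simp
    have "complex_of_real L * z $ i - (H *\<^sub>v z) $ i = 0"
      using p_index[OF i] p0 i by (metis index_zero_vec(1))
    then have "(H *\<^sub>v z) $ i = complex_of_real L * z $ i" by (metis right_minus_eq)
    then show "(H *\<^sub>v z) $ i = (complex_of_real L \<cdot>\<^sub>v z) $ i"
      using i carrier_vecD[OF z(1)] by (simp only: index_smult_vec)
  qed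
  moreover have "z \<noteq> 0\<^sub>v n" using z(2) sqnorm_eq_0_iff[OF z(1)] by auto
  ultimately have "eigenvalue H (complex_of_real L)"
    unfolding eigenvalue_def eigenvector_def carrier_matD(1)[OF H] using z(1) by blast
  moreover have L: "0 \<le> L" by (simp add: L_def sqnorm_nonneg)
  ultimately have "sqrt L \<in> singular_values A" 
    by (simp add: singular_values_def H_def flip: of_real_power)
  then show ?thesis using that[of "sqrt L"] z(3) L by (simp add: L_def)
qed

lemma sqnorm_mult_mat_vec_le:
  assumes A: "A \<in> carrier_mat n n" and v: "v \<in> carrier_vec n" and le: "spectral_norm A \<le> c"
  shows "sqnorm (A *\<^sub>v v) \<le> c\<^sup>2 * sqnorm v"
proof (cases "n = 0")
  case True
  then show ?thesis using A v by (simp add: sqnorm_def)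
next
  case False
  then obtain \<sigma> where \<sigma>: "\<sigma> \<in> singular_values A" "sqnorm (A *\<^sub>v v) \<le> \<sigma>\<^sup>2 * sqnorm v"
    using exists_max_singular_value[OF A] v by blast
  have "\<sigma> \<le> spectral_norm A"
    using A False \<sigma>(1) finite_singular_values[OF A] by (auto simp: spectral_norm_def)
  then have "\<sigma>\<^sup>2 \<le> c\<^sup>2" using le \<sigma>(1) by (intro power_mono) (auto simp: singular_values_def)
  then show ?thesis using \<sigma>(2) mult_right_mono[OF _ sqnorm_nonneg[of v]] by (meson order_trans)
qed

text \<open>An eigenvector \<open>v\<close> belonging to a singular value \<open>sigma\<close>
  satisfies \<open>sqnorm (A v) = sigma^2 * sqnorm v\<close>, so a contraction has no singular value
  above 1. Existence of a singular value makes \<open>Max\<close> an actual member.\<close>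

lemma spectral_norm_le_1:
  assumes A: "A \<in> carrier_mat n n"
    and contraction: "\<And>v. v \<in> carrier_vec n \<Longrightarrow> sqnorm (A *\<^sub>v v) \<le> sqnorm v"
  shows "spectral_norm A \<le> 1"
proof (cases "n = 0")
  case True
  then show ?thesis using A by (simp add: spectral_norm_def)
next
  case False
  then have ne: "singular_values A \<noteq> {}" using exists_max_singular_value[OF A] by blast
  have "\<sigma> \<le> 1" if sv: "\<sigma> \<in> singular_values A" for \<sigma>
  proof -
    have H: "mat_adjoint A * A \<in> carrier_mat n n" using A mat_adjoint_carrier[OF A] by simp
    obtain v where v: "v \<in> carrier_vec n" "v \<noteq> 0\<^sub>v n"
      "(mat_adjoint A * A) *\<^sub>v v = complex_of_real (\<sigma>\<^sup>2) \<cdot>\<^sub>v v"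
      using sv unfolding singular_values_def eigenvalue_def eigenvector_def carrier_matD(1)[OF H]
      by blast
    have "complex_of_real (sqnorm (A *\<^sub>v v)) = (\<Sum>i<n. (A *\<^sub>v v) $ i * cnj ((A *\<^sub>v v) $ i))"
      using A v by (intro inner_self_sqnorm[symmetric]) auto
    also have "\<dots> = (\<Sum>i<n. ((mat_adjoint A * A) *\<^sub>v v) $ i * cnj (v $ i))"
      using adjoint_inner[OF A v(1) v(1)] by simp
    also have "\<dots> = (\<Sum>i<n. complex_of_real (\<sigma>\<^sup>2) * (v $ i * cnj (v $ i)))"
      unfolding v(3) using v(1) by (intro sum.cong) auto
    also have "\<dots> = complex_of_real (\<sigma>\<^sup>2 * sqnorm v)"
      unfolding sum_distrib_left[symmetric] inner_self_sqnorm[OF v(1)] by simp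
    finally have "sqnorm (A *\<^sub>v v) = \<sigma>\<^sup>2 * sqnorm v" by (simp only: of_real_eq_iff)
    moreover have "0 < sqnorm v"
      using sqnorm_nonneg[of v] sqnorm_eq_0_iff[OF v(1)] v(2) by simp
    ultimately have "\<sigma>\<^sup>2 \<le> 1" using contraction[OF v(1)] by simp
    then show ?thesis by (simp add: abs_square_le_1)
  qed
  then show ?thesis
    using ne A False finite_singular_values[OF A] by (auto simp: spectral_norm_def)
qed

section \<open>Block diagonal matrices\<close>

text \<open>Blocks are numbered from 0 here but from 1 in the uncertainty structure: block
  \<open>k\<close> of \<open>ks\<close> has index \<open>k + 1\<close> there.\<close>

fun block_of :: "nat list \<Rightarrow> nat \<Rightarrow> nat" where
  "block_of [] i = 0"
| "block_of (k # ks) i = (if i < k then 0 else Suc (block_of ks (i - k)))"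

definition block_start :: "nat list \<Rightarrow> nat \<Rightarrow> nat" where
  "block_start ks b = sum_list (take b ks)"

lemma block_of_bounds:
  assumes "i < sum_list ks"
  shows "block_of ks i < length ks" "block_start ks (block_of ks i) \<le> i"
    "i - block_start ks (block_of ks i) < ks ! block_of ks i"
proof -
  have "block_of ks i < length ks \<and> block_start ks (block_of ks i) \<le> i \<and>
    i - block_start ks (block_of ks i) < ks ! block_of ks i"
    using assms
  proof (induction ks arbitrary: i)
    case Nil
    then show ?case by simp
  next
    case (Cons k ks)
    show ?case
    proof (cases "i < k")
      case True
      then show ?thesis by (simp add: block_start_def)
    next
      case False
      then have "i - k < sum_list ks" using Cons.prems by simp
      from Cons.IH[OF this] False show ?thesis by (simp add: block_start_def) arith
    qed
  qed
  then show "block_of ks i < length ks" "block_start ks (block_of ks i) \<le> i"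
    "i - block_start ks (block_of ks i) < ks ! block_of ks i" by blast+
qed

text \<open>Turns block structure into conditions on indices. The induction peels off the leading
  block, which shifts both indices by its size.\<close>

lemma diag_block_mat_index:
  assumes "list_all2 (\<lambda>A k. A \<in> carrier_mat k k) As ks" "i < sum_list ks" "j < sum_list ks"
  shows "diag_block_mat As $$ (i, j) =
    (if block_of ks i = block_of ks j
     then (As ! block_of ks i) $$ (i - block_start ks (block_of ks i), j - block_start ks (block_of ks j))
     else 0)"
  using assms
proof (induction As ks arbitrary: i j rule: list_all2_induct)
  case Nil
  then show ?case by simp
next
  case (Cons A As k ks)
  have dims: "dim_row (diag_block_mat As) = sum_list ks" "dim_col (diag_block_mat As) = sum_list ks"
    using Cons.hyps(2) unfolding dim_diag_block_mat
    by (induction rule: list_all2_induct) auto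
  show ?case
  proof (cases "i < k \<or> j < k")
    case True
    then show ?thesis using Cons.hyps Cons.prems dims
      by (auto simp: Let_def block_start_def)
  next
    case False
    then have "diag_block_mat (A # As) $$ (i, j) = diag_block_mat As $$ (i - k, j - k)"
      using Cons.hyps Cons.prems dims by (auto simp: Let_def)
    then show ?thesis using False Cons.IH[of "i - k" "j - k"] Cons.prems
      by (auto simp: block_start_def)
  qed
qed

text \<open>Lets scalar blocks with a common scalar be merged into the single block of size
  \<open>s_bar\<close>.\<close>

lemma diag_block_mat_scalar:
  "diag_block_mat (map (\<lambda>i. d \<cdot>\<^sub>m 1\<^sub>m (g i)) is) =
    (d :: 'a :: comm_ring_1) \<cdot>\<^sub>m 1\<^sub>m (sum_list (map g is))"
proof (induction "is")
  case Nil
  then show ?case by auto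
next
  case (Cons a "is")
  show ?case
    by (rule eq_matI) (auto simp: Cons Let_def)
qed

text \<open>These zeros, off the blocks and off the diagonal of the scalar blocks, carry the
  structure into the estimates by absolute values.\<close>

lemma Delta_RC_zero_pattern:
  assumes ks: "ks = map ms [1..<f + s + 1]" and IRC: "IR \<union> IC = {1..f + s}"
    and D: "D \<in> Delta_RC f s ms IR IC"
  shows "D \<in> carrier_mat (sum_list ks) (sum_list ks)"
    and "\<lbrakk>i < sum_list ks; j < sum_list ks; block_of ks i \<noteq> block_of ks j\<rbrakk> \<Longrightarrow> D $$ (i, j) = 0"
    and "\<lbrakk>i < sum_list ks; j < sum_list ks; f \<le> block_of ks i; i \<noteq> j\<rbrakk> \<Longrightarrow> D $$ (i, j) = 0"
proof -
  obtain \<Delta> \<delta> where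
    D_eq: "D = diag_block_mat (map \<Delta> [1..<f + 1] @ map (\<lambda>i. \<delta> i \<cdot>\<^sub>m 1\<^sub>m (ms i)) [f + 1..<f + s + 1])"
    and \<Delta>: "\<forall>i\<in>{1..f}. (i \<in> IR \<longrightarrow> \<Delta> i \<in> real_mat (ms i)) \<and> (i \<in> IC \<longrightarrow> \<Delta> i \<in> carrier_mat (ms i) (ms i))"
    using D unfolding Delta_RC_def by blast
  define As where "As = map \<Delta> [1..<f + 1] @ map (\<lambda>i. \<delta> i \<cdot>\<^sub>m 1\<^sub>m (ms i)) [f + 1..<f + s + 1]"
  have \<Delta>': "\<Delta> i \<in> carrier_mat (ms i) (ms i)" if "1 \<le> i" "i \<le> f" for i
  proof -
    have "i \<in> IR \<or> i \<in> IC" using IRC that by auto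
    then show ?thesis using \<Delta> that by (auto simp: real_mat_def)
  qed
  have length_ks: "length ks = f + s" by (simp add: ks del: upt_Suc)
  have all2: "list_all2 (\<lambda>A k. A \<in> carrier_mat k k) As ks"
    unfolding list_all2_conv_all_nth As_def ks
    using \<Delta>' by (auto simp: nth_append simp del: upt_Suc)
  have dims: "map dim_row As = ks" "map dim_col As = ks"
    using all2 by (auto simp: list_all2_conv_all_nth intro!: nth_equalityI)
  have D': "D = diag_block_mat As" by (simp add: D_eq As_def)
  show "D \<in> carrier_mat (sum_list ks) (sum_list ks)"
    unfolding D' by (intro carrier_matI) (simp_all only: dim_diag_block_mat dims)
  show *: "D $$ (i, j) = 0" if "i < sum_list ks" "j < sum_list ks" "block_of ks i \<noteq> block_of ks j" for i j
    using diag_block_mat_index[OF all2 that(1,2)] that(3) by (simp add: D')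
  show "D $$ (i, j) = 0" if ij: "i < sum_list ks" "j < sum_list ks" "f \<le> block_of ks i" "i \<noteq> j"
  proof (cases "block_of ks i = block_of ks j")
    case True
    let ?k = "block_of ks i"
    note bi = block_of_bounds[OF ij(1)] and bj = block_of_bounds[OF ij(2)]
    \<comment> \<open>Position \<open>?k\<close> counted from 0 is the structure index
      \<open>?k + 1\<close>; the scalar blocks start at position \<open>f\<close>.\<close>
    have "[f + 1..<f + s + 1] ! (?k - f) = ?k + 1" "ks ! ?k = ms (?k + 1)"
      using bi(1) ij(3) by (auto simp: ks nth_upt simp del: upt_Suc)
    then have "As ! ?k = \<delta> (?k + 1) \<cdot>\<^sub>m 1\<^sub>m (ks ! ?k)"
      using bi(1) ij(3) by (simp add: As_def nth_append length_ks del: upt_Suc)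
    moreover have "i - block_start ks ?k \<noteq> j - block_start ks ?k"
      using bi(2) bj(2) True ij(4) by auto
    ultimately show ?thesis
      using diag_block_mat_index[OF all2 ij(1,2)] True bi(3) bj(3) by (simp add: D')
  next
    case False
    then show ?thesis using * ij by blast
  qed
qed

text \<open>The way back from entries to blocks. One \<open>d\<close> serves all scalar blocks, in
  preparation for merging them.\<close>

lemma diag_block_mat_of_pattern:
  assumes ks: "ks = map ms [1..<f + s + 1]" and D: "D \<in> carrier_mat (sum_list ks) (sum_list ks)"
    and off_block: "\<And>i j. \<lbrakk>i < sum_list ks; j < sum_list ks; block_of ks i \<noteq> block_of ks j\<rbrakk> \<Longrightarrow> D $$ (i, j) = 0"
    and scalar: "\<And>i j. \<lbrakk>i < sum_list ks; j < sum_list ks; f \<le> block_of ks i\<rbrakk> \<Longrightarrow>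
      D $$ (i, j) = (if i = j then d else 0)"
    and \<Delta>: "\<And>k. \<lbrakk>1 \<le> k; k \<le> f\<rbrakk> \<Longrightarrow> \<Delta> k \<in> carrier_mat (ms k) (ms k)"
      "\<And>i j. \<lbrakk>i < sum_list ks; j < sum_list ks; block_of ks i < f; block_of ks i = block_of ks j\<rbrakk> \<Longrightarrow>
        \<Delta> (block_of ks i + 1) $$ (i - block_start ks (block_of ks i), j - block_start ks (block_of ks i)) = D $$ (i, j)"
  shows "diag_block_mat (map \<Delta> [1..<f + 1] @ map (\<lambda>i. d \<cdot>\<^sub>m 1\<^sub>m (ms i)) [f + 1..<f + s + 1]) = (D :: 'a :: comm_ring_1 mat)"
proof -
  define As where "As = map \<Delta> [1..<f + 1] @ map (\<lambda>i. d \<cdot>\<^sub>m 1\<^sub>m (ms i)) [f + 1..<f + s + 1]"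
  have length_ks: "length ks = f + s" by (simp add: ks del: upt_Suc)
  have all2: "list_all2 (\<lambda>A k. A \<in> carrier_mat k k) As ks"
    unfolding list_all2_conv_all_nth As_def ks
    using \<Delta>(1) by (auto simp: nth_append simp del: upt_Suc)
  have dims: "map dim_row As = ks" "map dim_col As = ks"
    using all2 by (auto simp: list_all2_conv_all_nth intro!: nth_equalityI)
  have "diag_block_mat As = D"
  proof (rule eq_matI)
    show "dim_row (diag_block_mat As) = dim_row D" "dim_col (diag_block_mat As) = dim_col D"
      unfolding dim_diag_block_mat dims using D by auto
    fix i j assume "i < dim_row D" "j < dim_col D"
    then have ij: "i < sum_list ks" "j < sum_list ks" using D by auto
    note entry = diag_block_mat_index[OF all2 ij]
    let ?k = "block_of ks i"
    note bi = block_of_bounds[OF ij(1)] and bj = block_of_bounds[OF ij(2)]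
    consider "?k \<noteq> block_of ks j" | "?k = block_of ks j" "?k < f" | "?k = block_of ks j" "f \<le> ?k"
      by linarith
    then show "diag_block_mat As $$ (i, j) = D $$ (i, j)"
    proof cases
      case 1
      then show ?thesis using entry off_block[OF ij] by simp
    next
      case 2
      then have "As ! ?k = \<Delta> (?k + 1)" by (simp add: As_def nth_append del: upt_Suc)
      then show ?thesis using 2 entry \<Delta>(2)[OF ij] by simp
    next
      case 3
      have "[f + 1..<f + s + 1] ! (?k - f) = ?k + 1" "ks ! ?k = ms (?k + 1)"
        using bi(1) 3 by (auto simp: ks nth_upt simp del: upt_Suc)
      then have "As ! ?k = d \<cdot>\<^sub>m 1\<^sub>m (ks ! ?k)"
        using bi(1) 3 by (simp add: As_def nth_append length_ks del: upt_Suc)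
      moreover have "i - block_start ks ?k = j - block_start ks ?k \<longleftrightarrow> i = j"
        using bi(2) bj(2) 3 by auto
      ultimately show ?thesis using 3 entry scalar[OF ij] bi(3) bj(3) by simp
    qed
  qed
  then show ?thesis by (simp only: As_def)
qed

section \<open>Admissible pairs and structured matrices\<close>

text \<open>The rows of \<open>D\<close> in \<open>S\<close> see only the coordinates in
  \<open>S\<close>, so replacing \<open>x\<close> by its restriction \<open>z\<close> leaves these
  rows of the product unchanged, and the global norm bound applies to \<open>z\<close>. In use,
  \<open>S\<close> is a full block or a single scalar coordinate.\<close>

lemma restricted_sqnorm_le:
  assumes D: "D \<in> carrier_mat n n" and x: "x \<in> carrier_vec n" and le: "spectral_norm D \<le> c"
    and S: "S \<subseteq> {..<n}" "\<And>i j. \<lbrakk>i \<in> S; j < n; j \<notin> S\<rbrakk> \<Longrightarrow> D $$ (i, j) = 0"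
  shows "(\<Sum>i\<in>S. (cmod ((D *\<^sub>v x) $ i))\<^sup>2) \<le> c\<^sup>2 * (\<Sum>i\<in>S. (cmod (x $ i))\<^sup>2)"
proof -
  define z where "z = vec n (\<lambda>i. if i \<in> S then x $ i else 0)"
  have z: "z \<in> carrier_vec n" by (simp add: z_def)
  have Dz: "(D *\<^sub>v z) $ i = (D *\<^sub>v x) $ i" if "i \<in> S" for i
  proof -
    have i: "i < n" using that S(1) by auto
    show ?thesis
      unfolding mult_mat_vec_index_sum[OF D z i] mult_mat_vec_index_sum[OF D x i]
      using S(2)[OF that] by (intro sum.cong refl) (simp add: z_def)
  qed
  have "(\<Sum>i\<in>S. (cmod ((D *\<^sub>v x) $ i))\<^sup>2) = (\<Sum>i\<in>S. (cmod ((D *\<^sub>v z) $ i))\<^sup>2)"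
    by (intro sum.cong refl) (simp only: Dz)
  also have "\<dots> \<le> sqnorm (D *\<^sub>v z)"
    unfolding sqnorm_def using S(1) D by (intro sum_mono2) auto
  also have "\<dots> \<le> c\<^sup>2 * sqnorm z" using D z le by (rule sqnorm_mult_mat_vec_le)
  also have "sqnorm z = (\<Sum>i<n. if i \<in> S then (cmod (x $ i))\<^sup>2 else 0)"
    unfolding sqnorm_def carrier_vecD[OF z] by (intro sum.cong refl) (simp add: z_def)
  also have "\<dots> = (\<Sum>i\<in>S. (cmod (x $ i))\<^sup>2)"
    using S(1) by (simp add: sum.inter_restrict[symmetric] Int_absorb1)
  finally show ?thesis .
qed

text \<open>With \<open>y = D v\<close>, moduli give \<open>x \<le> M |y|\<close> entrywise. On full
  blocks \<open>w = |y| / c\<close> is admissible by the norm bound on the block; on scalar blocks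
  \<open>|y| \<le> c |v|\<close>, so \<open>w = x\<close> is large enough because \<open>M\<close>
  is nonnegative.\<close>

lemma admissible_of_structured:
  assumes M: "M \<in> nonneg_mat n" and D: "D \<in> carrier_mat n n"
    and off_block: "\<And>i j. \<lbrakk>i < n; j < n; b i \<noteq> b j\<rbrakk> \<Longrightarrow> D $$ (i, j) = 0"
    and diagonal: "\<And>i j. \<lbrakk>i < n; j < n; f \<le> b i; i \<noteq> j\<rbrakk> \<Longrightarrow> D $$ (i, j) = 0"
    and v: "v \<in> carrier_vec n" "v \<noteq> 0\<^sub>v n" "v = M *\<^sub>v (D *\<^sub>v v)"
    and c: "spectral_norm D \<le> c" "0 < c"
  shows "\<exists>x w. admissible n f b x w \<and> (\<exists>i<n. x i \<noteq> 0) \<and>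
    (\<forall>i<n. x i \<le> c * (\<Sum>j<n. Re (M $$ (i, j)) * w j))"
proof -
  define y where "y = D *\<^sub>v v"
  define x where "x = (\<lambda>i. cmod (v $ i))"
  define w where "w = (\<lambda>i. if b i < f then cmod (y $ i) / c else x i)"
  have y: "y \<in> carrier_vec n" using D v by (simp add: y_def)
  have Mc: "M \<in> carrier_mat n n" using M by (simp add: nonneg_mat_def)
  have "(\<Sum>i | i < n \<and> b i = k. (w i)\<^sup>2) \<le> (\<Sum>i | i < n \<and> b i = k. (x i)\<^sup>2)" if "k < f" for k
  proof -
    have "(\<Sum>i | i < n \<and> b i = k. (w i)\<^sup>2) = (\<Sum>i | i < n \<and> b i = k. (cmod (y $ i))\<^sup>2) / c\<^sup>2"
      unfolding sum_divide_distrib using that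
      by (intro sum.cong refl) (auto simp: w_def power_divide)
    also have "\<dots> \<le> (c\<^sup>2 * (\<Sum>i | i < n \<and> b i = k. (x i)\<^sup>2)) / c\<^sup>2"
      unfolding x_def y_def
      by (intro divide_right_mono restricted_sqnorm_le[OF D v(1) c(1)]) (auto intro: off_block)
    finally show ?thesis using c by simp
  qed
  then have adm: "admissible n f b x w"
    using c by (auto simp: admissible_def x_def w_def)
  have nonzero: "\<exists>i<n. x i \<noteq> 0" using v(1,2) by (auto simp: x_def intro!: eq_vecI)
  have y_le: "cmod (y $ i) \<le> c * w i" if "i < n" for i
  proof (cases "b i < f")
    case True
    then show ?thesis using c by (simp add: w_def)
  next
    case False
    \<comment> \<open>In a scalar block, row \<open>i\<close> of \<open>D\<close> can be nonzero
      only on the diagonal, so \<open>{i}\<close> is a valid choice of \<open>S\<close>.\<close>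
    have "(\<Sum>i\<in>{i}. (cmod (y $ i))\<^sup>2) \<le> c\<^sup>2 * (\<Sum>i\<in>{i}. (cmod (v $ i))\<^sup>2)"
      unfolding y_def using that False
      by (intro restricted_sqnorm_le[OF D v(1) c(1)]) (auto intro!: diagonal)
    then have "(cmod (y $ i))\<^sup>2 \<le> (c * cmod (v $ i))\<^sup>2" by (simp add: power_mult_distrib)
    then have "cmod (y $ i) \<le> c * cmod (v $ i)" by (rule power2_le_imp_le) (use c in auto)
    then show ?thesis using False by (simp add: w_def x_def)
  qed
  have "\<forall>i<n. x i \<le> c * (\<Sum>j<n. Re (M $$ (i, j)) * w j)"
  proof (intro allI impI)
    fix i assume i: "i < n"
    have entry: "cmod (M $$ (i, j)) = Re (M $$ (i, j))" if "j < n" for j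
    proof -
      have "M $$ (i, j) \<in> \<real>\<^sub>\<ge>\<^sub>0" using M i that by (auto simp: nonneg_mat_def)
      then show ?thesis by (simp add: complex_nonneg_Reals_iff cmod_eq_Re)
    qed
    have "v $ i = (\<Sum>j<n. M $$ (i, j) * y $ j)"
      using v(3) mult_mat_vec_index_sum[OF Mc y i] by (simp add: y_def)
    then have "x i \<le> (\<Sum>j<n. cmod (M $$ (i, j) * y $ j))"
      unfolding x_def by (simp only: norm_sum)
    also have "\<dots> \<le> (\<Sum>j<n. Re (M $$ (i, j)) * (c * w j))"
      unfolding norm_mult using entry y_le
      by (intro sum_mono mult_mono) (auto simp flip: entry)
    finally show "x i \<le> c * (\<Sum>j<n. Re (M $$ (i, j)) * w j)"
      by (simp add: sum_distrib_left ac_simps)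
  qed
  with adm nonzero show ?thesis by blast
qed

text \<open>On a block where \<open>x\<close> vanishes the denominator is 0 and the block is the zero matrix;
  this is harmless because \<open>w\<close> vanishes there as well.\<close>

definition dyad_mat ::
  "nat \<Rightarrow> nat \<Rightarrow> (nat \<Rightarrow> nat) \<Rightarrow> (nat \<Rightarrow> real) \<Rightarrow> (nat \<Rightarrow> real) \<Rightarrow> real \<Rightarrow> complex mat" where
  "dyad_mat n f b x w t = mat n n (\<lambda>(i, j). complex_of_real
     (if b i \<noteq> b j then 0
      else if b i < f then w i * x j / (t * (\<Sum>l | l < n \<and> b l = b i. (x l)\<^sup>2))
      else if i = j then 1 / t else 0))"

lemma dyad_mat_carrier: "dyad_mat n f b x w t \<in> carrier_mat n n"
  by (simp add: dyad_mat_def)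

lemma dyad_mat_mult_vec:
  assumes v: "v \<in> carrier_vec n" and i: "i < n"
  shows "(dyad_mat n f b x w t *\<^sub>v v) $ i =
    (if b i < f
     then complex_of_real (w i / (t * (\<Sum>l | l < n \<and> b l = b i. (x l)\<^sup>2))) *
       (\<Sum>j | j < n \<and> b j = b i. complex_of_real (x j) * v $ j)
     else complex_of_real (1 / t) * v $ i)"
proof -
  let ?D = "dyad_mat n f b x w t"
  have sum: "(?D *\<^sub>v v) $ i = (\<Sum>j<n. ?D $$ (i, j) * v $ j)"
    using dyad_mat_carrier v i by (rule mult_mat_vec_index_sum)
  show ?thesis
  proof (cases "b i < f")
    case True
    let ?g = "\<lambda>j. complex_of_real (w i / (t * (\<Sum>l | l < n \<and> b l = b i. (x l)\<^sup>2))) *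
      (complex_of_real (x j) * v $ j)"
    have "(\<Sum>j<n. ?D $$ (i, j) * v $ j) = (\<Sum>j<n. if b j = b i then ?g j else 0)"
      using i True by (intro sum.cong refl) (auto simp: dyad_mat_def)
    also have "\<dots> = (\<Sum>j | j < n \<and> b j = b i. ?g j)"
      by (subst sum.inter_filter[symmetric]) (auto intro!: sum.cong)
    finally show ?thesis using True unfolding sum by (simp add: sum_distrib_left)
  next
    case False
    have "(\<Sum>j<n. ?D $$ (i, j) * v $ j) = (\<Sum>j<n. if i = j then complex_of_real (1 / t) * v $ i else 0)"
      using i False by (intro sum.cong refl) (auto simp: dyad_mat_def)
    then show ?thesis using False i unfolding sum by simp
  qed
qed

text \<open>Turns an eigenpair \<open>t x = M w\<close> into a fixed point:
  \<open>M D x = M w / t = x\<close>. On a full block the factor \<open>x^T x\<close> cancels the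
  squared norm in the denominator.\<close>

lemma dyad_mat_mult_self:
  assumes adm: "admissible n f b x w" and i: "i < n"
  shows "(dyad_mat n f b x w t *\<^sub>v vec n (\<lambda>i. complex_of_real (x i))) $ i = complex_of_real (w i / t)"
proof (cases "b i < f")
  case True
  let ?X = "\<Sum>l | l < n \<and> b l = b i. (x l)\<^sup>2"
  have "(\<Sum>j | j < n \<and> b j = b i. complex_of_real (x j) * vec n (\<lambda>i. complex_of_real (x i)) $ j) =
      (\<Sum>j | j < n \<and> b j = b i. complex_of_real ((x j)\<^sup>2))"
    by (intro sum.cong refl) (auto simp: power2_eq_square)
  then have "(dyad_mat n f b x w t *\<^sub>v vec n (\<lambda>i. complex_of_real (x i))) $ i =
      complex_of_real (w i / (t * ?X)) * complex_of_real ?X"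
    using True i by (subst dyad_mat_mult_vec) (simp_all only: vec_carrier if_True of_real_sum)
  also have "\<dots> = complex_of_real (w i / (t * ?X) * ?X)" by (simp only: of_real_mult)
  also have "w i / (t * ?X) * ?X = w i / t"
  proof (cases "?X = 0")
    case True
    have "(w i)\<^sup>2 \<le> (\<Sum>l | l < n \<and> b l = b i. (w l)\<^sup>2)"
      using i by (intro member_le_sum[of i _ "\<lambda>l. (w l)\<^sup>2"]) auto
    also have "\<dots> \<le> ?X" using adm \<open>b i < f\<close> by (auto simp: admissible_def)
    finally have "w i = 0" using True by simp
    then show ?thesis by simp
  qed simp
  finally show ?thesis .
next
  case False
  then show ?thesis using adm i by (subst dyad_mat_mult_vec) (auto simp: admissible_def)
qed

text \<open>On a full block Cauchy-Schwarz bounds the product of \<open>x\<close> and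
  \<open>v\<close>, and admissibility bounds the norm of \<open>w\<close> by that of
  \<open>x\<close>, leaving the factor \<open>1 / t \<le> 1\<close>; scalar coordinates are
  multiplied by \<open>1 / t\<close>. The blocks partition the coordinates, so squared norms
  add.\<close>

lemma dyad_mat_contraction:
  assumes adm: "admissible n f b x w" and t: "1 \<le> t" and v: "v \<in> carrier_vec n"
  shows "sqnorm (dyad_mat n f b x w t *\<^sub>v v) \<le> sqnorm v"
proof -
  let ?y = "dyad_mat n f b x w t *\<^sub>v v"
  let ?B = "\<lambda>k. {i. i < n \<and> b i = k}"
  have block: "(\<Sum>i\<in>?B k. (cmod (?y $ i))\<^sup>2) \<le> (\<Sum>i\<in>?B k. (cmod (v $ i))\<^sup>2)" for k
  proof (cases "k < f")
    case True
    define X where "X = (\<Sum>i\<in>?B k. (x i)\<^sup>2)"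
    define V where "V = (\<Sum>i\<in>?B k. (cmod (v $ i))\<^sup>2)"
    define p where "p = (\<Sum>j\<in>?B k. complex_of_real (x j) * v $ j)"
    have nonneg: "0 \<le> X" "0 \<le> V" by (auto simp: X_def V_def intro: sum_nonneg)
    have "cmod p \<le> (\<Sum>j\<in>?B k. \<bar>x j\<bar> * \<bar>cmod (v $ j)\<bar>)"
      unfolding p_def by (rule order_trans[OF norm_sum]) (simp add: norm_mult)
    also have "\<dots> \<le> sqrt X * sqrt V"
      using L2_set_mult_ineq[of x "\<lambda>j. cmod (v $ j)" "?B k"] by (simp add: L2_set_def X_def V_def)
    finally have "(cmod p)\<^sup>2 \<le> (sqrt X * sqrt V)\<^sup>2" by (intro power_mono) auto
    then have p: "(cmod p)\<^sup>2 \<le> X * V" using nonneg by (simp add: power_mult_distrib)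
    have W: "(\<Sum>i\<in>?B k. (w i)\<^sup>2) \<le> X" using adm True by (auto simp: admissible_def X_def)
    have "(\<Sum>i\<in>?B k. (cmod (?y $ i))\<^sup>2) = (\<Sum>i\<in>?B k. (w i)\<^sup>2 * ((cmod p)\<^sup>2 / (t * X)\<^sup>2))"
    proof (intro sum.cong refl)
      fix i assume "i \<in> ?B k"
      then have "?y $ i = complex_of_real (w i / (t * X)) * p"
        using True v by (subst dyad_mat_mult_vec) (auto simp: X_def p_def)
      then show "(cmod (?y $ i))\<^sup>2 = (w i)\<^sup>2 * ((cmod p)\<^sup>2 / (t * X)\<^sup>2)"
        by (simp only: norm_mult norm_of_real power_mult_distrib power2_abs power_divide) simp
    qed
    also have "\<dots> = (\<Sum>i\<in>?B k. (w i)\<^sup>2) * ((cmod p)\<^sup>2 / (t * X)\<^sup>2)"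
      by (simp only: sum_distrib_right)
    also have "\<dots> \<le> X * ((X * V) / (t * X)\<^sup>2)"
      using W p nonneg by (intro mult_mono divide_right_mono) auto
    also have "\<dots> \<le> V"
    proof (cases "X = 0")
      case False
      then have "X * ((X * V) / (t * X)\<^sup>2) = V / t\<^sup>2" using t by (simp add: power2_eq_square)
      also have "\<dots> \<le> V / 1" using t nonneg by (intro divide_left_mono) auto
      finally show ?thesis by simp
    qed (use nonneg in simp)
    finally show ?thesis by (simp only: V_def)
  next
    case False
    show ?thesis
    proof (rule sum_mono)
      fix i assume i: "i \<in> ?B k"
      then have "?y $ i = complex_of_real (1 / t) * v $ i"
        using False v by (subst dyad_mat_mult_vec) auto
      then have "cmod (?y $ i) = cmod (v $ i) / t" using t by (simp add: norm_divide)
      also have "\<dots> \<le> cmod (v $ i) / 1" using t by (intro divide_left_mono) auto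
      finally show "(cmod (?y $ i))\<^sup>2 \<le> (cmod (v $ i))\<^sup>2" by (intro power_mono) auto
    qed
  qed
  have split: "(\<Sum>i<n. g i) = (\<Sum>k\<in>b ` {..<n}. \<Sum>i\<in>?B k. g i)" for g :: "nat \<Rightarrow> real"
    by (subst sum.image_gen[of _ _ b]) auto
  have "sqnorm ?y = (\<Sum>i<n. (cmod (?y $ i))\<^sup>2)"
    using carrier_matD(1)[OF dyad_mat_carrier] by (simp only: sqnorm_def dim_mult_mat_vec)
  also have "\<dots> \<le> (\<Sum>i<n. (cmod (v $ i))\<^sup>2)"
    unfolding split by (intro sum_mono block)
  finally show ?thesis using v by (simp add: sqnorm_def)
qed

section \<open>From the structured singular value to the matrix and its fixed vector\<close>

lemma one_minus_mult_mat_vec_eq_0_iff: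
  assumes A: "(A :: 'a :: comm_ring_1 mat) \<in> carrier_mat n n" and v: "v \<in> carrier_vec n"
  shows "(1\<^sub>m n - A) *\<^sub>v v = 0\<^sub>v n \<longleftrightarrow> v = A *\<^sub>v v"
proof -
  have Av: "A *\<^sub>v v \<in> carrier_vec n" using A v by simp
  have "(1\<^sub>m n - A) *\<^sub>v v = v - A *\<^sub>v v"
    using A v by (simp add: minus_mult_distrib_mat_vec[of _ n n])
  moreover have "v - A *\<^sub>v v = 0\<^sub>v n \<longleftrightarrow> v = A *\<^sub>v v"
  proof
    assume eq: "v - A *\<^sub>v v = 0\<^sub>v n"
    show "v = A *\<^sub>v v"
    proof (rule eq_vecI)
      show "dim_vec v = dim_vec (A *\<^sub>v v)" using v Av by (metis carrier_vecD)
      fix i assume "i < dim_vec (A *\<^sub>v v)"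
      then have i: "i < n" using Av by (metis carrier_vecD)
      have "(v - A *\<^sub>v v) $ i = v $ i - (A *\<^sub>v v) $ i"
        using i carrier_vecD[OF Av] by (intro index_minus_vec(1)) (simp only:)
      then show "v $ i = (A *\<^sub>v v) $ i" using eq i by (metis index_zero_vec(1) right_minus_eq)
    qed
  next
    assume "v = A *\<^sub>v v"
    then show "v - A *\<^sub>v v = 0\<^sub>v n" using v by (metis minus_cancel_vec)
  qed
  ultimately show ?thesis by simp
qed

text \<open>A value of at least 1 excludes the default 0, so the set of norms is nonempty, and its
  infimum is at most 1. Some member then lies below \<open>c\<close>, whether or not the infimum is
  attained.\<close>

lemma structured_singular_value_ge_1D:
  assumes "structured_singular_value M D \<ge> 1" "1 < c"
  obtains \<Delta> where "\<Delta> \<in> D" "det (1\<^sub>m (dim_row M) - M * \<Delta>) = 0" "spectral_norm \<Delta> < c"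
proof -
  define S where "S = {spectral_norm \<Delta> | \<Delta>. \<Delta> \<in> D \<and> det (1\<^sub>m (dim_row M) - M * \<Delta>) = 0}"
  have ex: "\<exists>\<Delta>\<in>D. det (1\<^sub>m (dim_row M) - M * \<Delta>) = 0" and "1 \<le> 1 / Inf S"
    using assms(1) unfolding structured_singular_value_def S_def by (auto split: if_splits)
  then have "Inf S \<le> 1" by (cases "Inf S \<le> 0") (auto simp: le_divide_eq)
  then have "Inf S < c" using assms(2) by simp
  moreover have "S \<noteq> {}" using ex by (auto simp: S_def)
  ultimately show ?thesis using cInf_lessD[of S c] that by (auto simp: S_def)
qed

theorem theorem4:
  fixes f s m s_bar :: nat
    and ms :: "nat \<Rightarrow> nat"
    and IR IC :: "nat set"
    and M :: "complex mat"
  assumes "\<forall>i\<in>{1..f+s}. 1 \<le> ms i"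
    and "(\<Sum>i\<in>{1..f+s}. ms i) = m"
    and "IR \<union> IC = {1..f+s}"
    and "IR \<inter> IC = {}"
    and "M \<in> nonneg_mat m"
    and "s_bar = (\<Sum>k\<in>{f+1..f+s}. ms k)"
    and "structured_singular_value M (Delta_RC f s ms IR IC) \<ge> 1"
  shows "\<exists>\<Delta>' \<Delta> \<delta>.
      (\<forall>k\<in>{1..f}. \<Delta> k \<in> carrier_mat (ms k) (ms k)) \<and>
      \<Delta>' = diag_block_mat (map \<Delta> [1..<f + 1] @ [\<delta> \<cdot>\<^sub>m 1\<^sub>m s_bar]) \<and>
      \<Delta>' \<in> Delta_RC f s ms IR IC \<inter> nonneg_mat m \<and>
      spectral_norm \<Delta>' \<le> 1 \<and>
      det (1\<^sub>m m - M * \<Delta>') = 0 \<and>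
      (\<exists>q \<in> nonneg_vec m. q \<noteq> 0\<^sub>v m \<and> q = (M * \<Delta>') *\<^sub>v q)"
proof -
  define ks where "ks = map ms [1..<f + s + 1]"
  define b where "b = block_of ks"
  have sum_ks: "sum_list ks = m"
    unfolding ks_def interv_sum_list_conv_sum_set_nat assms(2)[symmetric]
    by (intro sum.cong) auto
  have M: "M \<in> carrier_mat m m" using assms(5) by (simp add: nonneg_mat_def)
  have M_entry: "M $$ (i, j) = complex_of_real (Re (M $$ (i, j)))" "0 \<le> Re (M $$ (i, j))"
    if "i < m" "j < m" for i j
  proof -
    have "M $$ (i, j) \<in> \<real>\<^sub>\<ge>\<^sub>0" using assms(5) that by (auto simp: nonneg_mat_def)
    then show "M $$ (i, j) = complex_of_real (Re (M $$ (i, j)))" "0 \<le> Re (M $$ (i, j))"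
      by (auto simp: complex_nonneg_Reals_iff complex_eq_iff)
  qed
  have sub: "\<exists>x w. admissible m f b x w \<and> (\<exists>i<m. x i \<noteq> 0) \<and>
      (\<forall>i<m. x i \<le> c * (\<Sum>j<m. Re (M $$ (i, j)) * w j))" if c: "1 < c" for c
  proof -
    obtain D where D: "D \<in> Delta_RC f s ms IR IC" "det (1\<^sub>m m - M * D) = 0" "spectral_norm D < c"
      using structured_singular_value_ge_1D[OF assms(7) c] carrier_matD(1)[OF M] by metis
    note pattern = Delta_RC_zero_pattern[OF ks_def assms(3) D(1), unfolded sum_ks]
    have MD: "M * D \<in> carrier_mat m m" using M pattern(1) by simp
    obtain v where v: "v \<in> carrier_vec m" "v \<noteq> 0\<^sub>v m" "(1\<^sub>m m - M * D) *\<^sub>v v = 0\<^sub>v m"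
      using D(2) det_0_iff_vec_prod_zero[OF minus_carrier_mat[OF MD, of "1\<^sub>m m"]] by blast
    have "v = (M * D) *\<^sub>v v" using v(3) one_minus_mult_mat_vec_eq_0_iff[OF MD v(1)] by blast
    then have "v = M *\<^sub>v (D *\<^sub>v v)" using assoc_mult_mat_vec[OF M pattern(1) v(1)] by metis
    then show ?thesis
      using assms(5) pattern v(1,2) D(3) c unfolding b_def
      by (intro admissible_of_structured[of M m D _ f v c]) auto
  qed
  obtain x w t where adm: "admissible m f b x w" and x0: "\<exists>i<m. x i \<noteq> 0" and t: "1 \<le> t"
    and eigen: "\<And>i. i < m \<Longrightarrow> t * x i = (\<Sum>j<m. Re (M $$ (i, j)) * w j)"
    using nonneg_eigenpair[of m "\<lambda>i j. Re (M $$ (i, j))" f b, OF M_entry(2) sub] by blast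
  have nn: "0 \<le> x i" "0 \<le> w i" if "i < m" for i using adm that by (auto simp: admissible_def)
  define D where "D = dyad_mat m f b x w t"
  \<comment> \<open>The blocks of \<open>D\<close>, read off at their offsets; \<open>k - 1\<close>
    converts indices counted from 1 to positions counted from 0. \<open>Re\<close> makes every block
    real by construction and agrees with \<open>D\<close>, whose entries are real.\<close>
  define \<Delta> where "\<Delta> = (\<lambda>k. mat (ms k) (ms k) (\<lambda>(p, q). complex_of_real
    (Re (D $$ (block_start ks (k - 1) + p, block_start ks (k - 1) + q)))))"
  define \<delta> where "\<delta> = complex_of_real (1 / t)"
  define q where "q = vec m (\<lambda>i. complex_of_real (x i))"
  have D: "D \<in> carrier_mat m m" by (simp add: D_def dyad_mat_carrier)
  have D_blocks: "diag_block_mat (map \<Delta> [1..<f + 1] @ map (\<lambda>i. \<delta> \<cdot>\<^sub>m 1\<^sub>m (ms i)) [f + 1..<f + s + 1]) = D"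
  proof (rule diag_block_mat_of_pattern[OF ks_def, unfolded sum_ks])
    show "D \<in> carrier_mat m m" by (rule D)
    show "\<Delta> k \<in> carrier_mat (ms k) (ms k)" for k by (simp add: \<Delta>_def)
    fix i j assume ij: "i < m" "j < m"
    show "D $$ (i, j) = 0" if "block_of ks i \<noteq> block_of ks j"
      using ij that by (simp add: D_def dyad_mat_def b_def)
    show "D $$ (i, j) = (if i = j then \<delta> else 0)" if "f \<le> block_of ks i"
      using ij that by (auto simp: D_def dyad_mat_def b_def \<delta>_def)
    assume blk: "block_of ks i < f" "block_of ks i = block_of ks j"
    note bi = block_of_bounds[of i ks, unfolded sum_ks, OF ij(1)]
      and bj = block_of_bounds[of j ks, unfolded sum_ks, OF ij(2)]
    have "ks ! block_of ks i = ms (block_of ks i + 1)"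
      using blk(1) by (simp add: ks_def del: upt_Suc)
    moreover have "D $$ (i, j) = complex_of_real (Re (D $$ (i, j)))"
      using ij by (simp add: D_def dyad_mat_def)
    ultimately show "\<Delta> (block_of ks i + 1) $$
        (i - block_start ks (block_of ks i), j - block_start ks (block_of ks i)) = D $$ (i, j)"
      using bi bj blk(2) by (simp add: \<Delta>_def)
  qed
  have MD: "M * D \<in> carrier_mat m m" using M D by simp
  have q: "q \<in> carrier_vec m" by (simp add: q_def)
  have fixed: "q = (M * D) *\<^sub>v q"
  proof (rule eq_vecI)
    show "dim_vec q = dim_vec ((M * D) *\<^sub>v q)" using M q by simp
    fix i assume "i < dim_vec ((M * D) *\<^sub>v q)"
    then have i: "i < m" using M by simp
    have Dq: "D *\<^sub>v q \<in> carrier_vec m" using D q by simp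
    have Dq_index: "(D *\<^sub>v q) $ j = complex_of_real (w j / t)" if "j < m" for j
      unfolding D_def q_def using adm that by (rule dyad_mat_mult_self)
    have "((M * D) *\<^sub>v q) $ i = (\<Sum>j<m. M $$ (i, j) * (D *\<^sub>v q) $ j)"
      unfolding assoc_mult_mat_vec[OF M D q] using M Dq i by (rule mult_mat_vec_index_sum)
    also have "\<dots> = (\<Sum>j<m. complex_of_real (Re (M $$ (i, j)) * w j / t))"
      using M_entry(1)[OF i] Dq_index by (intro sum.cong refl) (metis lessThan_iff of_real_mult times_divide_eq_right)
    also have "\<dots> = complex_of_real ((\<Sum>j<m. Re (M $$ (i, j)) * w j) / t)"
      by (simp only: of_real_sum sum_divide_distrib)
    also have "\<dots> = q $ i" using eigen[OF i, symmetric] t i by (simp add: q_def)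
    finally show "q $ i = ((M * D) *\<^sub>v q) $ i" by (rule sym)
  qed
  have q0: "q \<noteq> 0\<^sub>v m"
  proof
    assume "q = 0\<^sub>v m"
    then have "q $ i = 0" if "i < m" for i using that by simp
    then show False using x0 by (auto simp: q_def)
  qed
  \<comment> \<open>All scalar blocks carry the same \<delta>, so they fuse into one block whose
    size is the sum of theirs.\<close>
  have "D = diag_block_mat (map \<Delta> [1..<f + 1] @ [\<delta> \<cdot>\<^sub>m 1\<^sub>m s_bar])"
  proof -
    have "s_bar = sum_list (map ms [f + 1..<f + s + 1])"
      unfolding interv_sum_list_conv_sum_set_nat assms(6) by (intro sum.cong) auto
    then show ?thesis
      unfolding D_blocks[symmetric] diag_block_mat_append diag_block_mat_scalar diag_block_mat_singleton
      by (simp only:)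
  qed
  moreover have "\<forall>k\<in>{1..f}. \<Delta> k \<in> carrier_mat (ms k) (ms k)" by (simp add: \<Delta>_def)
  moreover have "D \<in> Delta_RC f s ms IR IC"
  proof -
    \<comment> \<open>Real blocks and a real scalar are allowed for indices in \<open>IR\<close> and
      in \<open>IC\<close> alike.\<close>
    have "\<Delta> k \<in> real_mat (ms k)" for k
      by (auto simp: real_mat_def \<Delta>_def elements_mat_def)
    moreover have "\<delta> \<in> \<real>" by (simp add: \<delta>_def)
    ultimately show ?thesis
      unfolding Delta_RC_def using D_blocks
      by (intro CollectI exI[of _ \<Delta>] exI[of _ "\<lambda>_. \<delta>"]) (auto simp: real_mat_def)
  qed
  moreover have "D \<in> nonneg_mat m"
  proof -
    have "D $$ (i, j) \<in> \<real>\<^sub>\<ge>\<^sub>0" if "i < m" "j < m" for i j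
      using that nn t
      by (auto simp: D_def dyad_mat_def intro!: divide_nonneg_nonneg mult_nonneg_nonneg sum_nonneg)
    then show ?thesis using D by (auto simp: nonneg_mat_def)
  qed
  moreover have "spectral_norm D \<le> 1"
    using D dyad_mat_contraction[OF adm t] unfolding D_def by (rule spectral_norm_le_1)
  moreover have "q \<in> nonneg_vec m" using nn by (auto simp: nonneg_vec_def q_def)
  moreover have "det (1\<^sub>m m - M * D) = 0"
    using det_0_iff_vec_prod_zero[OF minus_carrier_mat[OF MD, of "1\<^sub>m m"]] q q0 fixed
      one_minus_mult_mat_vec_eq_0_iff[OF MD q] by blast
  ultimately show ?thesis using fixed q0
    by (intro exI[of _ D] exI[of _ \<Delta>] exI[of _ \<delta>] conjI IntI bexI[of _ q])
qed

end
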